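(* Let $\mathbb F$ be an algebraically closed field, let $V$ be a vector space over $\mathbb F$ of dimension $d+1$ with $d\ge3$, and let $A,A^*$ be a Leonard pair on $V$. Then the following are equivalent: (i) $A,A^*$ has spin; (ii) $A,A^*$ is self-dual and ${\mathcal Z}(A,A^* )\neq0$.
   Context: A tridiagonal matrix is irreducible if all entries on its subdiagonal and superdiagonal are nonzero. A Leonard pair on $V$ is an ordered pair $A,A^*\in \mathrm{End}(V)$ such that (i) there is a basis of $V$ with respect to which $A$ is irreducible tridiagonal and $A^*$ is diagonal; (ii) there is a basis of $V$ with respect to which $A^*$ is irreducible tridiagonal and $A$ is diagonal. Then $A$ and $A^*$ are multiplicity-free (diagonalizable with one-dimensional eigenspaces). The Leonard pair $A,A^*$ is said to have spin whenever there exist invertible $W,W^*\in\mathrm{End}(V)$ such that $WA=AW$, $W^*A^*=A^*W^*$, and $WA^*W^{-1}=(W^* )^{-1}AW^*$. The Leonard pair $A,A^*$ is self-dual whenever it is isomorphic to the Leonard pair $A^*,A$, i.e. there is an $\mathbb F$-algebra isomorphism $\sigma:\mathrm{End}(V)\to\mathrm{End}(V)$ with $A^\sigma=A^*$ and $(A^* )^\sigma=A$. Zero diagonal space: let $\{E^*_i\}_{i=0}^d$ be the primitive idempotents of $A^*$ (the projections onto the eigenspaces of $A^*$ along the sum of the other eigenspaces). Then ${\mathcal Z}(A,A^* )$ is the set of $X\in\mathrm{Span}\{I,A^*,A,AA^*\}$ such that $E^*_iXE^*_i=0$ for $0\le i\le d$. *)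

theory Defs
  imports Complex_Main "HOL-Computational_Algebra.Polynomial"
begin

text \<open>A matrix with rows and columns indexed by \<open>0, \<dots>, n - 1\<close> is a function of two indices that is
  only inspected below \<open>n\<close>.\<close>

definition diagonal_matrix :: "nat \<Rightarrow> (nat \<Rightarrow> nat \<Rightarrow> 'f::zero) \<Rightarrow> bool" where
  "diagonal_matrix n M \<longleftrightarrow> (\<forall>i<n. \<forall>j<n. i \<noteq> j \<longrightarrow> M i j = 0)"

definition tridiagonal_matrix :: "nat \<Rightarrow> (nat \<Rightarrow> nat \<Rightarrow> 'f::zero) \<Rightarrow> bool" where
  "tridiagonal_matrix n M \<longleftrightarrow> (\<forall>i<n. \<forall>j<n. (i + 1 < j \<or> j + 1 < i) \<longrightarrow> M i j = 0)"

definition irreducible_tridiagonal_matrix :: "nat \<Rightarrow> (nat \<Rightarrow> nat \<Rightarrow> 'f::zero) \<Rightarrow> bool" where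
  "irreducible_tridiagonal_matrix n M \<longleftrightarrow>
     tridiagonal_matrix n M \<and> (\<forall>i. i + 1 < n \<longrightarrow> M i (i + 1) \<noteq> 0 \<and> M (i + 1) i \<noteq> 0)"

text \<open>The vector space \<open>V\<close> is the whole type \<open>'v\<close> with scalar multiplication \<open>s\<close>; elements of
  \<open>End(V)\<close> are functions on that type and the product of \<open>End(V)\<close> is composition. The definitions are
  meant for \<open>vector_space s\<close>; \<open>module.span s\<close>, \<open>vector_space.dim s\<close> and so on are the constants
  of the library locales.\<close>

definition End :: "('f::field \<Rightarrow> 'v::ab_group_add \<Rightarrow> 'v) \<Rightarrow> ('v \<Rightarrow> 'v) set" where
  "End s = {T. Vector_Spaces.linear s s T}"

definition invertible_End :: "('f::field \<Rightarrow> 'v::ab_group_add \<Rightarrow> 'v) \<Rightarrow> ('v \<Rightarrow> 'v) \<Rightarrow> bool" where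
  "invertible_End s W \<longleftrightarrow> W \<in> End s \<and> bij W"

definition dimV :: "('f::field \<Rightarrow> 'v::ab_group_add \<Rightarrow> 'v) \<Rightarrow> nat" where
  "dimV s = vector_space.dim s (UNIV :: 'v set)"

definition ordered_basis :: "('f::field \<Rightarrow> 'v::ab_group_add \<Rightarrow> 'v) \<Rightarrow> (nat \<Rightarrow> 'v) \<Rightarrow> bool" where
  "ordered_basis s e \<longleftrightarrow> inj_on e {..<dimV s} \<and>
     \<not> module.dependent s (e ` {..<dimV s}) \<and> module.span s (e ` {..<dimV s}) = UNIV"

text \<open>Column \<open>j\<close> holds the coordinates of the image of the \<open>j\<close>-th basis vector.\<close>

definition matrix_wrt ::
  "('f::field \<Rightarrow> 'v::ab_group_add \<Rightarrow> 'v) \<Rightarrow> (nat \<Rightarrow> 'v) \<Rightarrow> ('v \<Rightarrow> 'v) \<Rightarrow> nat \<Rightarrow> nat \<Rightarrow> 'f" where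
  "matrix_wrt s e T i j = module.representation s (e ` {..<dimV s}) (T (e j)) (e i)"

definition leonard_pair ::
  "('f::field \<Rightarrow> 'v::ab_group_add \<Rightarrow> 'v) \<Rightarrow> ('v \<Rightarrow> 'v) \<Rightarrow> ('v \<Rightarrow> 'v) \<Rightarrow> bool" where
  "leonard_pair s A As \<longleftrightarrow> A \<in> End s \<and> As \<in> End s \<and>
     (\<exists>e. ordered_basis s e \<and>
        irreducible_tridiagonal_matrix (dimV s) (matrix_wrt s e A) \<and>
        diagonal_matrix (dimV s) (matrix_wrt s e As)) \<and>
     (\<exists>e. ordered_basis s e \<and>
        irreducible_tridiagonal_matrix (dimV s) (matrix_wrt s e As) \<and>
        diagonal_matrix (dimV s) (matrix_wrt s e A))"

definition has_spin ::
  "('f::field \<Rightarrow> 'v::ab_group_add \<Rightarrow> 'v) \<Rightarrow> ('v \<Rightarrow> 'v) \<Rightarrow> ('v \<Rightarrow> 'v) \<Rightarrow> bool" where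
  "has_spin s A As \<longleftrightarrow> (\<exists>W Ws. invertible_End s W \<and> invertible_End s Ws \<and>
     W \<circ> A = A \<circ> W \<and> Ws \<circ> As = As \<circ> Ws \<and>
     W \<circ> As \<circ> inv W = inv Ws \<circ> A \<circ> Ws)"

definition End_algebra_iso ::
  "('f::field \<Rightarrow> 'v::ab_group_add \<Rightarrow> 'v) \<Rightarrow> (('v \<Rightarrow> 'v) \<Rightarrow> ('v \<Rightarrow> 'v)) \<Rightarrow> bool" where
  "End_algebra_iso s \<sigma> \<longleftrightarrow> bij_betw \<sigma> (End s) (End s) \<and>
     (\<forall>X\<in>End s. \<forall>Y\<in>End s. \<sigma> (\<lambda>v. X v + Y v) = (\<lambda>v. \<sigma> X v + \<sigma> Y v)) \<and>
     (\<forall>c. \<forall>X\<in>End s. \<sigma> (\<lambda>v. s c (X v)) = (\<lambda>v. s c (\<sigma> X v))) \<and>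
     (\<forall>X\<in>End s. \<forall>Y\<in>End s. \<sigma> (X \<circ> Y) = \<sigma> X \<circ> \<sigma> Y) \<and>
     \<sigma> id = id"

definition leonard_pairs_isomorphic :: "('f::field \<Rightarrow> 'v::ab_group_add \<Rightarrow> 'v) \<Rightarrow>
    ('v \<Rightarrow> 'v) \<Rightarrow> ('v \<Rightarrow> 'v) \<Rightarrow> ('v \<Rightarrow> 'v) \<Rightarrow> ('v \<Rightarrow> 'v) \<Rightarrow> bool" where
  "leonard_pairs_isomorphic s A As B Bs \<longleftrightarrow>
     (\<exists>\<sigma>. End_algebra_iso s \<sigma> \<and> \<sigma> A = B \<and> \<sigma> As = Bs)"

definition self_dual ::
  "('f::field \<Rightarrow> 'v::ab_group_add \<Rightarrow> 'v) \<Rightarrow> ('v \<Rightarrow> 'v) \<Rightarrow> ('v \<Rightarrow> 'v) \<Rightarrow> bool" where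
  "self_dual s A As \<longleftrightarrow> leonard_pairs_isomorphic s A As As A"

definition eigenspace ::
  "('f::field \<Rightarrow> 'v::ab_group_add \<Rightarrow> 'v) \<Rightarrow> ('v \<Rightarrow> 'v) \<Rightarrow> 'f \<Rightarrow> 'v set" where
  "eigenspace s T \<theta> = {v. T v = s \<theta> v}"

definition eigenvalue ::
  "('f::field \<Rightarrow> 'v::ab_group_add \<Rightarrow> 'v) \<Rightarrow> ('v \<Rightarrow> 'v) \<Rightarrow> 'f \<Rightarrow> bool" where
  "eigenvalue s T \<theta> \<longleftrightarrow> (\<exists>v. v \<noteq> 0 \<and> T v = s \<theta> v)"

text \<open>The projection onto \<open>S\<close> along \<open>K\<close>: the idempotent with image \<open>S\<close> and kernel \<open>K\<close>.\<close>

definition is_projection ::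
  "('f::field \<Rightarrow> 'v::ab_group_add \<Rightarrow> 'v) \<Rightarrow> ('v \<Rightarrow> 'v) \<Rightarrow> 'v set \<Rightarrow> 'v set \<Rightarrow> bool" where
  "is_projection s E S K \<longleftrightarrow> E \<in> End s \<and> E \<circ> E = E \<and> range E = S \<and> {v. E v = 0} = K"

text \<open>The span of a union of subspaces is their sum. For diagonalizable \<open>T\<close> every eigenvalue has
  exactly one such idempotent, so ranging over all of them is ranging over the index \<open>i\<close> in
  \<open>E\<^sub>i\<close>.\<close>

definition primitive_idempotent ::
  "('f::field \<Rightarrow> 'v::ab_group_add \<Rightarrow> 'v) \<Rightarrow> ('v \<Rightarrow> 'v) \<Rightarrow> ('v \<Rightarrow> 'v) \<Rightarrow> bool" where
  "primitive_idempotent s T E \<longleftrightarrow> (\<exists>\<theta>. eigenvalue s T \<theta> \<and>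
     is_projection s E (eigenspace s T \<theta>)
       (module.span s (\<Union>\<mu>\<in>{\<mu>. eigenvalue s T \<mu> \<and> \<mu> \<noteq> \<theta>}. eigenspace s T \<mu>)))"

definition zero_diagonal_space ::
  "('f::field \<Rightarrow> 'v::ab_group_add \<Rightarrow> 'v) \<Rightarrow> ('v \<Rightarrow> 'v) \<Rightarrow> ('v \<Rightarrow> 'v) \<Rightarrow> ('v \<Rightarrow> 'v) set" where
  "zero_diagonal_space s A As =
     {X. (\<exists>a b c e. X = (\<lambda>v. s a v + s b (As v) + s c (A v) + s e (A (As v)))) \<and>
         (\<forall>E. primitive_idempotent s As E \<longrightarrow> E \<circ> X \<circ> E = (\<lambda>v. 0))}"

end

theory Submission
  imports Defs
begin

text \<open>
  Let \<open>v\<close> and \<open>u\<close> be eigenbases of \<open>A\<^sup>*\<close> and \<open>A\<close>, with eigenvalues \<open>\<theta>\<^sup>*\<^sub>i\<close> and \<open>\<theta>\<^sub>i\<close>.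

  Suppose the pair has spin. There is a symmetric bilinear form for which \<open>A\<close>, \<open>A\<^sup>*\<close>, \<open>W\<close>, \<open>W\<^sup>*\<close> are
  self-adjoint; taking adjoints in the spin relation shows that conjugation by \<open>W W\<^sup>* W\<close> exchanges
  \<open>A\<close> and \<open>A\<^sup>*\<close>. The map \<open>B = W A\<^sup>* W\<^sup>-\<^sup>1 = (W\<^sup>*)\<^sup>-\<^sup>1 A W\<^sup>*\<close> is tridiagonal in both bases, hence lies in the
  span of \<open>I, A, A\<^sup>*, AA\<^sup>*, A\<^sup>*A\<close>. In the basis \<open>v\<close> it has the same diagonal as \<open>A\<close>, and replacing
  \<open>A\<^sup>*A\<close> by \<open>AA\<^sup>*\<close> in \<open>B - A\<close> gives an element of the zero diagonal space.

  Conversely, self-duality is inner, so one may take \<open>\<theta>\<^sup>*\<^sub>i = \<theta>\<^sub>i\<close> and the same matrix for \<open>A\<close> in \<open>v\<close> and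
  \<open>A\<^sup>*\<close> in \<open>u\<close>. It suffices to find \<open>B = x\<^sub>0 + x\<^sub>1 (A + A\<^sup>*) + x\<^sub>3 AA\<^sup>* + x\<^sub>4 A\<^sup>*A\<close> whose entries next to the
  diagonal are those of \<open>A\<close> up to factors \<open>w\<^sub>j / w\<^sub>i\<close>. The Askey-Wilson relation gives
  \<open>a\<^sub>i P(\<theta>\<^sub>i) = Q(\<theta>\<^sub>i)\<close> for the diagonal entries \<open>a\<^sub>i\<close>, with quadratics \<open>P\<close> and \<open>Q\<close>; an element of the zero
  diagonal space says \<open>a\<^sub>i R(\<theta>\<^sub>i) = N(\<theta>\<^sub>i)\<close> with \<open>R\<close> and \<open>N\<close> of degree at most 1. The cubic \<open>N P - R Q\<close> has
  \<open>d + 1 \<ge> 4\<close> roots, so it vanishes, and the factorization \<open>P = R S\<close>, \<open>Q = N S\<close> provides the \<open>x\<^sub>i\<close>.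
  No division by 2 occurs, so the characteristic plays no role.
\<close>

section \<open>The polynomial equations\<close>

text \<open>This turns an identity at four or more distinct eigenvalues into an identity of
  coefficients.\<close>

lemma cubic_coeffs_eq_0:
  fixes c0 c1 c2 c3 :: "'f::field"
  assumes "finite S" "card S \<ge> 4" "\<And>t. t \<in> S \<Longrightarrow> c0 + c1 * t + c2 * t^2 + c3 * t^3 = 0"
  shows "c0 = 0 \<and> c1 = 0 \<and> c2 = 0 \<and> c3 = 0"
proof -
  define p where "p = [:c0, c1, c2, c3:]"
  have "p = 0"
  proof (rule ccontr)
    assume "p \<noteq> 0"
    have "S \<subseteq> {x. poly p x = 0}"
      using assms(3) by (auto simp: p_def algebra_simps power2_eq_square power3_eq_cube)
    then have "card S \<le> card {x. poly p x = 0}"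
      using poly_roots_finite[OF \<open>p \<noteq> 0\<close>] card_mono by blast
    also have "\<dots> \<le> degree p"
      by (rule card_poly_roots_bound[OF \<open>p \<noteq> 0\<close>])
    also have "\<dots> \<le> 3" by (simp add: p_def)
    finally show False using assms(2) by simp
  qed
  then show ?thesis by (simp add: p_def)
qed

text \<open>The two numbers are the roots of a monic quadratic; this recovers \<open>x3\<close> and
  \<open>x4\<close> from their sum and product.\<close>

lemma sum_product_exists:
  fixes y k :: "'f::alg_closed_field"
  shows "\<exists>x z. x + z = y \<and> x * z = k"
proof -
  have "\<exists>x. poly [:k, - y, 1:] x = 0"
    by (rule alg_closed_imp_poly_has_root) simp
  then obtain x where "k + x * (- y + x) = 0"
    by auto
  then have "x + (y - x) = y \<and> x * (y - x) = k"
    by (simp add: algebra_simps)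
  then show ?thesis by blast
qed

lemma square_root_exists:
  fixes k :: "'f::alg_closed_field"
  shows "\<exists>y. y^2 = k"
proof -
  have "\<exists>x. poly [:- k, 0, 1:] x = 0"
    by (rule alg_closed_imp_poly_has_root) simp
  then show ?thesis by (auto simp: power2_eq_square)
qed

text \<open>With \<open>y = x3 + x4\<close> and \<open>\<kappa> = x3 * x4\<close>, the conditions on \<open>\<kappa>\<close> say that
  \<open>\<kappa> P(t) = (y t + x1 - 1) (y t + x1 + 1)\<close> and determine which multiples of \<open>R\<close> and \<open>S\<close> to take as the two factors.\<close>

lemma spin_parameters_factored:
  fixes n0 n1 r0 r1 s0 s1 :: "'f::field"
  assumes P: "2 - \<beta> = r1 * s1" "- 2 * \<gamma> = r1 * s0 + r0 * s1" "- \<rho> = r0 * s0"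
    and Q: "\<gamma> = n1 * s1" "\<omega> = n1 * s0 + n0 * s1" "\<eta> = n0 * s0"
    and R: "r0 \<noteq> 0 \<or> r1 \<noteq> 0"
    and a0: "(r0 + r1 * t) * a = n0 + n1 * t"
    and nondeg: "\<omega> - \<rho> + \<gamma> * (a + t) - (2 - \<beta>) * t * a \<noteq> 0"
  obtains x0 x1 y \<kappa> lam where "\<kappa> * (2 - \<beta>) = y^2" "\<kappa> * \<gamma> = - (x1 * y)" "\<kappa> * \<rho> = 1 - x1^2"
    "y = lam * r1" "x1 - 1 = lam * r0" "x1 = - (lam * n1)" "x0 = - (lam * n0)"
proof -
  have det: "r1 * s0 + s1 * (r0 + 2 * n1) = 0"
    using P(2) Q(1) by algebra
  have S: "s0 \<noteq> 0 \<or> s1 \<noteq> 0"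
    using nondeg P Q by auto
  \<comment> \<open>If \<open>n1 = - r0\<close>, then \<open>det\<close> makes \<open>R\<close> and
    \<open>S\<close> proportional, and both coefficients of \<open>R\<close> annihilate the
    expression \<open>D\<close> that \<open>nondeg\<close> keeps away from 0.\<close>
  have ne: "n1 + r0 \<noteq> 0"
  proof
    assume eq: "n1 + r0 = 0"
    then have par: "r1 * s0 = r0 * s1" using det by algebra
    have n1: "n1 = - r0" using eq by algebra
    define D where "D = \<omega> - \<rho> + \<gamma> * (a + t) - (2 - \<beta>) * t * a"
    have D: "D = - r0 * s0 + n0 * s1 + r0 * s0 - r0 * s1 * (a + t) - r1 * s1 * t * a"
      unfolding D_def using P Q n1 by algebra
    have "r0 * D = 0" "r1 * D = 0"
      using par a0 n1 unfolding D by algebra+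
    then show False using R nondeg D_def by auto
  qed
  \<comment> \<open>This value makes \<open>x1 - 1 = lam * r0\<close> compatible with
    \<open>x1 = - (lam * n1)\<close>.\<close>
  define lam where "lam = - 1 / (n1 + r0)"
  have l: "lam * (n1 + r0) = - 1" using ne by (simp add: lam_def)
  \<comment> \<open>By \<open>det\<close>, the pair \<open>(r1, - (2 * n1 + r0))\<close> is a
    multiple \<open>m\<close> of \<open>(s1, s0)\<close>. Then \<open>y * t + x1 - 1\<close> is
    \<open>lam * R\<close> and \<open>y * t + x1 + 1\<close> is \<open>lam * m * S\<close>, whence
    \<open>\<kappa> = lam^2 * m\<close>.\<close>
  obtain m where m: "m * s1 = r1" "m * s0 = - (2 * n1 + r0)"
  proof (cases "s1 = 0")
    case True
    then have "r1 = 0" using det S by auto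
    then show ?thesis using True S that[of "- (2 * n1 + r0) / s0"] by auto
  next
    case False
    have "(r1 / s1) * s0 = - (2 * n1 + r0)"
      using False det by (simp add: field_simps) algebra
    then show ?thesis using False that[of "r1 / s1"] by auto
  qed
  show thesis
  proof (rule that[of "lam^2 * m" "lam * r1" "- (lam * n1)" lam "- (lam * n0)"])
    show "lam^2 * m * (2 - \<beta>) = (lam * r1)^2" using P(1) m by algebra
    show "lam^2 * m * \<gamma> = - (- (lam * n1) * (lam * r1))" using Q(1) m by algebra
    show "lam^2 * m * \<rho> = 1 - (- (lam * n1))^2" using P(3) m(2) l by algebra
    show "- (lam * n1) - 1 = lam * r0" using l by algebra
  qed auto
qed

text \<open>For a constant diagonal \<open>\<nu>\<close> the diagonal condition is solved
  identically in \<open>s\<close>, by \<open>x1 = - (y * \<nu>)\<close> and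
  \<open>x0 = \<nu> * (1 - x1)\<close>. With \<open>y\<close> a square root of
  \<open>\<kappa> * (2 - \<beta>)\<close>, what remains is
  \<open>\<kappa> * (\<rho> + \<nu> * \<gamma>) = 1\<close>, and the expression in
  \<open>nondeg\<close> is minus the second factor.\<close>

lemma spin_parameters_constant:
  fixes \<nu> :: "'f::alg_closed_field"
  assumes Q: "\<gamma> = \<nu> * (2 - \<beta>)" "\<omega> = - 2 * \<nu> * \<gamma>"
    and nondeg: "\<omega> - \<rho> + \<gamma> * (\<nu> + t) - (2 - \<beta>) * t * \<nu> \<noteq> 0"
  obtains x0 x1 y \<kappa> where "\<kappa> * (2 - \<beta>) = y^2" "\<kappa> * \<gamma> = - (x1 * y)" "\<kappa> * \<rho> = 1 - x1^2"
    "\<And>s. x0 + x1 * s + (x1 - 1 + y * s) * \<nu> = 0"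
proof -
  have ne: "\<rho> + \<nu> * \<gamma> \<noteq> 0"
  proof
    assume "\<rho> + \<nu> * \<gamma> = 0"
    then have "\<omega> - \<rho> + \<gamma> * (\<nu> + t) - (2 - \<beta>) * t * \<nu> = 0"
      using Q by algebra
    then show False using nondeg by simp
  qed
  define \<kappa> where "\<kappa> = 1 / (\<rho> + \<nu> * \<gamma>)"
  have k: "\<kappa> * (\<rho> + \<nu> * \<gamma>) = 1" using ne by (simp add: \<kappa>_def)
  obtain y where y: "y^2 = \<kappa> * (2 - \<beta>)" using square_root_exists by blast
  show thesis
  proof (rule that[of \<kappa> y "- (y * \<nu>)" "\<nu> * (1 + y * \<nu>)"])
    show "\<kappa> * \<gamma> = - (- (y * \<nu>) * y)" using y Q by algebra
    show "\<kappa> * \<rho> = 1 - (- (y * \<nu>))^2" using y Q k by algebra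
  qed (use y in \<open>simp_all add: algebra_simps\<close>)
qed

text \<open>This supplies the input of \<open>has_spin_if_parameters\<close>, with
  \<open>a i\<close> the diagonal entries. The unknowns \<open>y = x3 + x4\<close> and
  \<open>\<kappa> = x3 * x4\<close> are found first.\<close>

lemma spin_parameters:
  fixes th a :: "nat \<Rightarrow> 'f::alg_closed_field"
  assumes inj: "inj_on th {..<n}" and n: "n \<ge> 4"
    and curve: "\<And>i. i + 1 < n \<Longrightarrow>
      th i^2 + th (i + 1)^2 - \<beta> * th i * th (i + 1) - \<gamma> * (th i + th (i + 1)) - \<rho> = 0"
    and PQ: "\<And>i. i < n \<Longrightarrow> a i * ((2 - \<beta>) * th i^2 - 2 * \<gamma> * th i - \<rho>) = \<gamma> * th i^2 + \<omega> * th i + \<eta>"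
    and nondeg: "\<omega> - \<rho> + \<gamma> * (a 0 + th 0) - (2 - \<beta>) * th 0 * a 0 \<noteq> 0"
    and Z: "\<And>i. i < n \<Longrightarrow> p + q * th i + (r0 + r1 * th i) * a i = 0"
    and nz: "p \<noteq> 0 \<or> q \<noteq> 0 \<or> r0 \<noteq> 0 \<or> r1 \<noteq> 0"
  obtains x0 x1 x3 x4 where
    "\<And>i. i < n \<Longrightarrow> x0 + x1 * th i + (x1 - 1 + (x3 + x4) * th i) * a i = 0"
    "\<And>i. i + 1 < n \<Longrightarrow>
      (x1 + x3 * th (i + 1) + x4 * th i) * (x1 + x3 * th i + x4 * th (i + 1)) = 1"
proof -
  have card: "card (th ` {..<n}) \<ge> 4" using inj n by (simp add: card_image)
  obtain x0 x1 y \<kappa> where S: "\<kappa> * (2 - \<beta>) = y^2" "\<kappa> * \<gamma> = - (x1 * y)" "\<kappa> * \<rho> = 1 - x1^2"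
    and D: "\<And>i. i < n \<Longrightarrow> x0 + x1 * th i + (x1 - 1 + y * th i) * a i = 0"
  proof -
    note result = that
    define n0 where "n0 = - p"
    define n1 where "n1 = - q"
    have RN: "(r0 + r1 * th i) * a i = n0 + n1 * th i" if "i < n" for i
      using Z[OF that] unfolding n0_def n1_def by algebra
    \<comment> \<open>These are the coefficients of the cubic \<open>N * P - R * Q\<close>, constant
      term first.\<close>
    have "- n0 * \<rho> - r0 * \<eta> = 0 \<and>
      - n1 * \<rho> - 2 * n0 * \<gamma> - r1 * \<eta> - r0 * \<omega> = 0 \<and>
      n0 * (2 - \<beta>) - 2 * n1 * \<gamma> - r0 * \<gamma> - r1 * \<omega> = 0 \<and>
      n1 * (2 - \<beta>) - r1 * \<gamma> = 0"
    proof (rule cubic_coeffs_eq_0[OF _ card])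
      fix t assume "t \<in> th ` {..<n}"
      then obtain i where i: "i < n" "t = th i" by auto
      show "- n0 * \<rho> - r0 * \<eta> + (- n1 * \<rho> - 2 * n0 * \<gamma> - r1 * \<eta> - r0 * \<omega>) * t +
        (n0 * (2 - \<beta>) - 2 * n1 * \<gamma> - r0 * \<gamma> - r1 * \<omega>) * t^2 + (n1 * (2 - \<beta>) - r1 * \<gamma>) * t^3 = 0"
        using RN[OF i(1)] PQ[OF i(1)] unfolding i(2) by algebra
    qed simp
    then have c: "n0 * \<rho> + r0 * \<eta> = 0" "n1 * \<rho> + 2 * n0 * \<gamma> + r1 * \<eta> + r0 * \<omega> = 0"
      "n0 * (2 - \<beta>) - 2 * n1 * \<gamma> - r0 * \<gamma> - r1 * \<omega> = 0" "n1 * (2 - \<beta>) = r1 * \<gamma>"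
      by algebra+
    \<comment> \<open>Without \<open>R\<close>, the linear polynomial \<open>N\<close> would have at
      least four roots, against \<open>nz\<close>.\<close>
    have Rne: "r0 \<noteq> 0 \<or> r1 \<noteq> 0"
    proof (rule ccontr)
      assume "\<not> ?thesis"
      then have r: "r0 = 0" "r1 = 0" by auto
      have "n0 = 0 \<and> n1 = 0 \<and> (0::'f) = 0 \<and> (0::'f) = 0"
        by (rule cubic_coeffs_eq_0[OF _ card]) (use RN r in auto)
      then show False using r nz by (simp add: n0_def n1_def)
    qed
    have factored: ?thesis if F: "2 - \<beta> = r1 * s1" "- 2 * \<gamma> = r1 * s0 + r0 * s1" "- \<rho> = r0 * s0"
      "\<gamma> = n1 * s1" "\<omega> = n1 * s0 + n0 * s1" "\<eta> = n0 * s0" for s0 s1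
    proof -
      have a0: "(r0 + r1 * th 0) * a 0 = n0 + n1 * th 0" using RN n by auto
      obtain x0 x1 y \<kappa> lam where x: "\<kappa> * (2 - \<beta>) = y^2" "\<kappa> * \<gamma> = - (x1 * y)" "\<kappa> * \<rho> = 1 - x1^2"
        "y = lam * r1" "x1 - 1 = lam * r0" "x1 = - (lam * n1)" "x0 = - (lam * n0)"
        by (rule spin_parameters_factored[OF F Rne a0 nondeg])
      have "x0 + x1 * th i + (x1 - 1 + y * th i) * a i = 0" if "i < n" for i
        using RN[OF that] x(4-7) by algebra
      with x(1-3) show ?thesis by (rule result)
    qed
    have const: ?thesis if \<nu>: "\<And>i. i < n \<Longrightarrow> a i = \<nu>" "\<gamma> = \<nu> * (2 - \<beta>)" "\<omega> = - 2 * \<nu> * \<gamma>" for \<nu>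
    proof -
      have "\<omega> - \<rho> + \<gamma> * (\<nu> + th 0) - (2 - \<beta>) * th 0 * \<nu> \<noteq> 0"
        using nondeg \<nu>(1)[of 0] n by auto
      from spin_parameters_constant[OF \<nu>(2,3) this]
      obtain x0 x1 y \<kappa> where x: "\<kappa> * (2 - \<beta>) = y^2" "\<kappa> * \<gamma> = - (x1 * y)" "\<kappa> * \<rho> = 1 - x1^2"
        "\<And>s. x0 + x1 * s + (x1 - 1 + y * s) * \<nu> = 0" by metis
      have "x0 + x1 * th i + (x1 - 1 + y * th i) * a i = 0" if "i < n" for i
        by (simp add: \<nu>(1)[OF that] x(4))
      with x(1-3) show ?thesis by (rule result)
    qed
    show ?thesis
    \<comment> \<open>From \<open>N * P = R * Q\<close>, either \<open>R\<close> divides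
      \<open>P\<close> and \<open>S = P / R\<close> gives the factorization, or
      \<open>N = \<nu> * R\<close> and the diagonal is constant. For \<open>r1 = 0\<close> the value
      of \<open>n1\<close> separates the two cases; otherwise it is the value of \<open>P\<close> at
      the root \<open>r\<close> of \<open>R\<close>.\<close>
    proof (cases "r1 = 0")
      case True
      then have r0: "r0 \<noteq> 0" using Rne by simp
      show ?thesis
      proof (cases "n1 = 0")
        case n1: True
        define \<nu> where "\<nu> = n0 / r0"
        have n0: "n0 = \<nu> * r0" using r0 by (simp add: \<nu>_def)
        show ?thesis
        proof (rule const)
          show "a i = \<nu>" if "i < n" for i
            using RN[OF that] r0 True n1 by (simp add: \<nu>_def field_simps)
          have "r0 * (\<gamma> - \<nu> * (2 - \<beta>)) = 0" using c(3) n0 n1 True by algebra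
          then show "\<gamma> = \<nu> * (2 - \<beta>)" using r0 by simp
          have "r0 * (\<omega> - (- 2 * \<nu> * \<gamma>)) = 0" using c(2) n0 n1 True by algebra
          then show "\<omega> = - 2 * \<nu> * \<gamma>" using r0 by (simp add: eq_neg_iff_add_eq_0)
        qed
      next
        case False
        then have b: "2 - \<beta> = 0" using c(4) True by auto
        define s0 where "s0 = - \<rho> / r0"
        define s1 where "s1 = - 2 * \<gamma> / r0"
        have s: "- \<rho> = r0 * s0" "- 2 * \<gamma> = r0 * s1"
          using r0 by (simp_all add: s0_def s1_def)
        have "r0 * (\<gamma> - n1 * s1) = 0" "r0 * (\<omega> - (n1 * s0 + n0 * s1)) = 0" "r0 * (\<eta> - n0 * s0) = 0"
          using c s b True by algebra+
        then have "\<gamma> = n1 * s1" "\<omega> = n1 * s0 + n0 * s1" "\<eta> = n0 * s0"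
          using r0 by auto
        then show ?thesis using s b True by (intro factored[of s1 s0]) auto
      qed
    next
      case r1: False
      define r where "r = - r0 / r1"
      have r0: "r0 = - (r1 * r)" using r1 by (simp add: r_def)
      define Pr where "Pr = (2 - \<beta>) * r^2 - 2 * \<gamma> * r - \<rho>"
      have Nr: "(n0 + n1 * r) * Pr = 0" unfolding Pr_def using c r0 by algebra
      show ?thesis
      proof (cases "Pr = 0")
        case True
        define s1 where "s1 = (2 - \<beta>) / r1"
        define s0 where "s0 = ((2 - \<beta>) * r - 2 * \<gamma>) / r1"
        have s: "2 - \<beta> = r1 * s1" "(2 - \<beta>) * r - 2 * \<gamma> = r1 * s0"
          using r1 by (simp_all add: s0_def s1_def)
        have P: "- 2 * \<gamma> = r1 * s0 + r0 * s1" "- \<rho> = r0 * s0"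
          using s r0 True unfolding Pr_def by algebra+
        have g: "r1 * (\<gamma> - n1 * s1) = 0"
          using c(4) s by algebra
        then have g: "\<gamma> = n1 * s1" using r1 by auto
        have "r1 * (\<omega> - (n1 * s0 + n0 * s1)) = 0"
          using c(3) s P g by algebra
        then have w: "\<omega> = n1 * s0 + n0 * s1" using r1 by auto
        have "r1 * (\<eta> - n0 * s0) = 0"
          using c(2) s P g w by algebra
        then have "\<eta> = n0 * s0" using r1 by auto
        with s(1) P g w show ?thesis by (rule factored)
      next
        case False
        define \<nu> where "\<nu> = n1 / r1"
        have n1: "n1 = \<nu> * r1" using r1 by (simp add: \<nu>_def)
        have "n0 + n1 * r = 0" using Nr False by simp
        then have n0: "n0 = \<nu> * r0" using n1 r0 by algebra
        have "r1 * (\<gamma> - \<nu> * (2 - \<beta>)) = 0" using c(4) n1 by algebra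
        then have g: "\<gamma> = \<nu> * (2 - \<beta>)" using r1 by simp
        have "r1 * (\<omega> - (- 2 * \<nu> * \<gamma>)) = 0" using c(3) n0 n1 g by algebra
        then have w: "\<omega> = - 2 * \<nu> * \<gamma>" using r1 by (simp add: eq_neg_iff_add_eq_0)
        have "r1 * (\<eta> - (- \<nu> * \<rho>)) = 0" using c(2) n0 n1 g w by algebra
        then have e: "\<eta> = - \<nu> * \<rho>" using r1 by (simp add: eq_neg_iff_add_eq_0)
        have "a i = \<nu>" if i: "i < n" for i
        \<comment> \<open>At the root of \<open>R\<close> the zero diagonal equation says nothing
          about \<open>a i\<close>; there \<open>a i * P = Q = \<nu> * P\<close> with
          \<open>P\<close> nonzero decides.\<close>
        proof (cases "r0 + r1 * th i = 0")
          case True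
          have "r1 * (th i - r) = 0" using True r0 by algebra
          then have thr: "th i = r" using r1 by simp
          have "(a i - \<nu>) * Pr = 0" using PQ[OF i] g w e thr unfolding Pr_def by algebra
          then show ?thesis using False by auto
        next
          case ne: False
          have "(r0 + r1 * th i) * (a i - \<nu>) = 0" using RN[OF i] n0 n1 by algebra
          then show ?thesis using ne by auto
        qed
        then show ?thesis using g w by (rule const)
      qed
    qed
  qed
  obtain x3 x4 where x34: "x3 + x4 = y" "x3 * x4 = \<kappa>" using sum_product_exists by blast
  show thesis
  proof (rule that[of x0 x1 x3 x4])
    show "x0 + x1 * th i + (x1 - 1 + (x3 + x4) * th i) * a i = 0" if "i < n" for i
      using D[OF that] x34 by simp
    show "(x1 + x3 * th (i + 1) + x4 * th i) * (x1 + x3 * th i + x4 * th (i + 1)) = 1"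
      if "i + 1 < n" for i
    proof -
      define s where "s = th i"
      define t where "t = th (i + 1)"
      have "s^2 + t^2 - \<beta> * s * t - \<gamma> * (s + t) - \<rho> = 0"
        using curve[OF that] unfolding s_def t_def .
      \<comment> \<open>By \<open>S\<close>, the left side minus 1 is \<open>\<kappa>\<close> times
        the polynomial of the curve.\<close>
      then have "(x1 + x3 * t + x4 * s) * (x1 + x3 * s + x4 * t) = 1"
        using S x34 by algebra
      then show ?thesis unfolding s_def t_def .
    qed
  qed
qed

section \<open>Coordinates\<close>

context vector_space
begin

lemma EndI:
  assumes "\<And>x y. T (x + y) = T x + T y" "\<And>a x. T (scale a x) = scale a (T x)"
  shows "T \<in> End scale"
  using assms by (simp add: End_def Vector_Spaces.linear_iff vector_space_axioms)

lemma
  assumes "T \<in> End scale"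
  shows End_add: "T (x + y) = T x + T y"
    and End_scale: "T (scale a x) = scale a (T x)"
    and End_zero: "T 0 = 0"
    and End_diff: "T (x - y) = T x - T y"
    and End_sum: "T (sum f I) = (\<Sum>i\<in>I. T (f i))"
proof -
  interpret T: Vector_Spaces.linear scale scale T using assms by (simp add: End_def)
  show "T (x + y) = T x + T y" "T (scale a x) = scale a (T x)" "T 0 = 0" "T (x - y) = T x - T y"
    "T (sum f I) = (\<Sum>i\<in>I. T (f i))"
    by (simp_all add: T.add T.scale T.zero T.diff T.sum)
qed

lemma End_comp: "S \<in> End scale \<Longrightarrow> T \<in> End scale \<Longrightarrow> S \<circ> T \<in> End scale"
  by (rule EndI) (simp_all add: End_add End_scale)

lemma End_inv:
  assumes "invertible_End scale T"
  shows "inv T \<in> End scale"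
proof -
  have T: "T \<in> End scale" and b: "bij T" using assms by (auto simp: invertible_End_def)
  note s = surj_f_inv_f[OF bij_is_surj[OF b]] and i = injD[OF bij_is_inj[OF b]]
  show ?thesis
    by (rule EndI; rule i; simp add: s End_add[OF T] End_scale[OF T])
qed

end

text \<open>A basis is bundled with its coordinate functionals, so that several bases of one space
  can be handled side by side and transported along invertible maps.\<close>

locale coords = vector_space scale
  for scale :: "'f::field \<Rightarrow> 'v::ab_group_add \<Rightarrow> 'v" (infixr "*s" 75) +
  fixes n :: nat and e :: "nat \<Rightarrow> 'v" and c :: "nat \<Rightarrow> 'v \<Rightarrow> 'f"
  assumes c_add: "c i (x + y) = c i x + c i y"
    and c_scale: "c i (a *s x) = a * c i x"
    and expand: "(\<Sum>i<n. c i x *s e i) = x"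
    and c_e: "i < n \<Longrightarrow> j < n \<Longrightarrow> c i (e j) = (if i = j then 1 else 0)"
begin

lemma c_zero: "c i 0 = 0"
  using c_scale[of i 0 0] by simp

lemma c_minus: "c i (- x) = - c i x"
  using c_add[of i x "- x"] by (simp add: c_zero add_eq_0_iff)

lemma c_diff: "c i (x - y) = c i x - c i y"
  using c_add[of i x "- y"] by (simp add: c_minus)

lemma c_sum: "c i (sum f I) = (\<Sum>j\<in>I. c i (f j))"
  by (induction I rule: infinite_finite_induct) (simp_all add: c_zero c_add)

lemmas c_linear = c_zero c_minus c_diff c_add c_scale c_sum

lemma coords_eqI:
  assumes "\<And>i. i < n \<Longrightarrow> c i x = c i y"
  shows "x = y"
proof -
  have "(\<Sum>i<n. c i x *s e i) = (\<Sum>i<n. c i y *s e i)"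
    using assms by simp
  then show ?thesis by (simp only: expand)
qed

lemma functional_expand:
  fixes \<phi> :: "'v \<Rightarrow> 'f"
  assumes "\<And>x y. \<phi> (x + y) = \<phi> x + \<phi> y" "\<And>a x. \<phi> (a *s x) = a * \<phi> x"
  shows "\<phi> x = (\<Sum>i<n. c i x * \<phi> (e i))"
proof -
  have z: "\<phi> 0 = 0" using assms(2)[of 0 0] by simp
  have s: "\<phi> (sum f I) = (\<Sum>j\<in>I. \<phi> (f j))" for f and I :: "nat set"
    by (induction I rule: infinite_finite_induct) (simp_all add: z assms)
  show ?thesis by (subst expand[symmetric, of x]) (simp add: s assms)
qed

lemma End_expand:
  assumes "T \<in> End scale"
  shows "T x = (\<Sum>j<n. c j x *s T (e j))"
  by (subst expand[symmetric, of x]) (simp add: End_sum[OF assms] End_scale[OF assms])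

lemma c_End:
  assumes "T \<in> End scale"
  shows "c i (T x) = (\<Sum>j<n. c j x * c i (T (e j)))"
  by (subst End_expand[OF assms]) (simp add: c_linear)

lemma End_eqI:
  assumes "S \<in> End scale" "T \<in> End scale" "\<And>i j. i < n \<Longrightarrow> j < n \<Longrightarrow> c i (S (e j)) = c i (T (e j))"
  shows "S x = T x"
proof -
  have "S (e j) = T (e j)" if "j < n" for j
    using assms(3)[OF _ that] by (rule coords_eqI)
  then show ?thesis
    by (simp add: End_expand[OF assms(1), of x] End_expand[OF assms(2), of x])
qed

lemma e_nonzero: "i < n \<Longrightarrow> e i \<noteq> 0"
  using c_e[of i i] c_zero[of i] by auto

lemma c_eigenbasis:
  assumes "T \<in> End scale" "\<And>j. j < n \<Longrightarrow> T (e j) = t j *s e j" "i < n"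
  shows "c i (T x) = t i * c i x"
proof -
  have "c i (T x) = (\<Sum>j<n. if j = i then t i * c i x else 0)"
    by (subst c_End[OF assms(1)], rule sum.cong) (auto simp: assms c_linear c_e)
  then show ?thesis using assms(3) by simp
qed

section \<open>Diagonal operators, primitive idempotents and the zero diagonal space\<close>

definition diag :: "(nat \<Rightarrow> 'f) \<Rightarrow> 'v \<Rightarrow> 'v" where
  "diag w x = (\<Sum>i<n. (w i * c i x) *s e i)"

lemma diag_End: "diag w \<in> End scale"
  by (rule EndI) (simp_all add: diag_def c_linear algebra_simps sum.distrib scale_sum_right)

lemma c_diag: "i < n \<Longrightarrow> c i (diag w x) = w i * c i x"
  by (simp add: diag_def c_linear c_e if_distrib cong: if_cong)

lemma diag_e: "j < n \<Longrightarrow> diag w (e j) = w j *s e j"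
  by (rule coords_eqI) (simp add: c_diag c_linear c_e)

lemma invertible_diag:
  assumes "\<And>i. i < n \<Longrightarrow> w i \<noteq> 0"
  shows "invertible_End scale (diag w)"
proof -
  have 1: "diag (\<lambda>i. 1 / w i) (diag w x) = x" for x
    by (rule coords_eqI) (simp add: c_diag assms)
  have 2: "diag w (diag (\<lambda>i. 1 / w i) x) = x" for x
    by (rule coords_eqI) (simp add: c_diag assms)
  have "bij (diag w)" by (rule o_bij[of "diag (\<lambda>i. 1 / w i)"]) (auto simp: 1 2)
  then show ?thesis by (simp add: invertible_End_def diag_End)
qed

text \<open>Comparing \<open>i\<close>-th coordinates of \<open>W (T (e j))\<close> and
  \<open>T (W (e j))\<close> gives a factor \<open>t i - t j\<close>, which is nonzero off the
  diagonal.\<close>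

lemma commuting_diagonal:
  assumes T: "T \<in> End scale" "\<And>j. j < n \<Longrightarrow> T (e j) = t j *s e j" and "inj_on t {..<n}"
    and W: "W \<in> End scale" "\<And>x. W (T x) = T (W x)" and j: "j < n"
  shows "W (e j) = c j (W (e j)) *s e j"
proof (rule coords_eqI)
  fix i assume i: "i < n"
  have "t i * c i (W (e j)) = c i (W (T (e j)))"
    using c_eigenbasis[OF T i] W(2) by metis
  also have "\<dots> = t j * c i (W (e j))"
    using T(2)[OF j] by (simp add: End_scale[OF W(1)] c_linear)
  finally have "(t i - t j) * c i (W (e j)) = 0" by (simp add: algebra_simps)
  then show "c i (W (e j)) = c i (c j (W (e j)) *s e j)"
    using assms(3) i j by (auto simp: c_linear c_e dest: inj_onD)
qed

text \<open>With distinct eigenvalues, eigenspaces and their complements are cut out by vanishing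
  coordinates, and a projection is determined by its image and kernel.\<close>

lemma primitive_idempotent_iff:
  assumes T: "T \<in> End scale" "\<And>j. j < n \<Longrightarrow> T (e j) = t j *s e j" and inj: "inj_on t {..<n}"
  shows "primitive_idempotent scale T E \<longleftrightarrow> (\<exists>i<n. E = (\<lambda>x. c i x *s e i))"
proof -
  note cT = c_eigenbasis[OF T]
  have eigen: "T x = \<mu> *s x \<longleftrightarrow> (\<forall>i<n. c i x = 0 \<or> t i = \<mu>)" for x \<mu>
  proof
    assume *: "T x = \<mu> *s x"
    show "\<forall>i<n. c i x = 0 \<or> t i = \<mu>"
    proof (intro allI impI)
      fix i assume "i < n"
      then have "t i * c i x = \<mu> * c i x" by (simp only: cT[symmetric] * c_scale)
      then show "c i x = 0 \<or> t i = \<mu>" by (metis mult_cancel_right)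
    qed
  next
    assume *: "\<forall>i<n. c i x = 0 \<or> t i = \<mu>"
    show "T x = \<mu> *s x"
      by (rule coords_eqI) (use * in \<open>auto simp: cT c_linear\<close>)
  qed
  have ev: "eigenvalue scale T \<mu> \<longleftrightarrow> (\<exists>i<n. \<mu> = t i)" for \<mu>
  proof
    assume "eigenvalue scale T \<mu>"
    then obtain x where x: "x \<noteq> 0" "T x = \<mu> *s x" by (auto simp: eigenvalue_def)
    then have "\<exists>i<n. c i x \<noteq> 0" using coords_eqI[of x 0] by (auto simp: c_zero)
    then show "\<exists>i<n. \<mu> = t i" using x(2) eigen by metis
  next
    assume "\<exists>i<n. \<mu> = t i"
    then show "eigenvalue scale T \<mu>" using T(2) e_nonzero by (auto simp: eigenvalue_def)
  qed
  have es: "eigenspace scale T (t i) = {x. \<forall>j<n. j \<noteq> i \<longrightarrow> c j x = 0}" if "i < n" for i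
    using inj that by (auto simp: eigenspace_def eigen dest: inj_onD)
  have ker: "span (\<Union>\<mu>\<in>{\<mu>. eigenvalue scale T \<mu> \<and> \<mu> \<noteq> t i}. eigenspace scale T \<mu>) = {x. c i x = 0}"
    (is "span ?U = ?K") if i: "i < n" for i
  proof
    have "subspace ?K" by (rule subspaceI) (simp_all add: c_linear)
    moreover have "?U \<subseteq> ?K" using i by (auto simp: eigenspace_def eigen)
    ultimately show "span ?U \<subseteq> ?K" by (rule span_minimal[rotated])
    show "?K \<subseteq> span ?U"
    proof
      fix x assume x: "x \<in> ?K"
      have "(\<Sum>j<n. c j x *s e j) \<in> span ?U"
      proof (rule span_sum)
        fix j assume j: "j \<in> {..<n}"
        show "c j x *s e j \<in> span ?U"
        proof (cases "j = i")
          case True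
          then show ?thesis using x by (simp add: span_zero)
        next
          case False
          then have "t j \<noteq> t i" using inj i j by (auto dest: inj_onD)
          then have "e j \<in> ?U" using j ev T(2) by (auto simp: eigenspace_def)
          then show ?thesis by (intro span_scale span_base)
        qed
      qed
      then show "x \<in> span ?U" by (simp only: expand)
    qed
  qed
  have proj: "is_projection scale E {x. \<forall>j<n. j \<noteq> i \<longrightarrow> c j x = 0} {x. c i x = 0} \<longleftrightarrow>
      E = (\<lambda>x. c i x *s e i)" if i: "i < n" for i
  proof
    assume "is_projection scale E {x. \<forall>j<n. j \<noteq> i \<longrightarrow> c j x = 0} {x. c i x = 0}"
    then have E: "E \<in> End scale" "\<And>x. E (E x) = E x"
      "range E = {x. \<forall>j<n. j \<noteq> i \<longrightarrow> c j x = 0}" "{x. E x = 0} = {x. c i x = 0}"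
      by (auto simp: is_projection_def fun_eq_iff)
    have "e i \<in> range E" using i by (auto simp: E(3) c_e)
    then have 1: "E (e i) = e i" using E(2) by auto
    have 2: "E (e j) = 0" if "j < n" "j \<noteq> i" for j
      using E(4) i that by (auto simp: set_eq_iff c_e)
    show "E = (\<lambda>x. c i x *s e i)"
    proof
      fix x
      have "E x = (\<Sum>j<n. if j = i then c i x *s e i else 0)"
        by (subst End_expand[OF E(1)], rule sum.cong) (auto simp: 1 2)
      then show "E x = c i x *s e i" using i by simp
    qed
  next
    assume E: "E = (\<lambda>x. c i x *s e i)"
    show "is_projection scale E {x. \<forall>j<n. j \<noteq> i \<longrightarrow> c j x = 0} {x. c i x = 0}"
      unfolding is_projection_def
    proof (intro conjI)
      show "E \<in> End scale" unfolding E by (rule EndI) (simp_all add: c_linear algebra_simps)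
      show "E \<circ> E = E" using i by (auto simp: E c_linear c_e)
      show "{x. E x = 0} = {x. c i x = 0}" using e_nonzero[OF i] by (simp add: E)
      have "x = E x" if "\<forall>j<n. j \<noteq> i \<longrightarrow> c j x = 0" for x
        by (rule coords_eqI) (use that i in \<open>simp add: E c_linear c_e\<close>)
      then show "range E = {x. \<forall>j<n. j \<noteq> i \<longrightarrow> c j x = 0}"
        using i by (auto simp: E c_linear c_e)
    qed
  qed
  show ?thesis
    unfolding primitive_idempotent_def using ev es ker proj by auto
qed

text \<open>Compressing \<open>X\<close> by the \<open>i\<close>-th idempotent multiplies that
  idempotent by the \<open>(i, i)\<close> entry of \<open>X\<close>, so membership becomes one
  scalar equation per index. Nonvanishing is expressed by the operator, not by its four
  coefficients.\<close>

lemma zero_diagonal_space_iff: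
  assumes T: "T \<in> End scale" "\<And>j. j < n \<Longrightarrow> T (e j) = t j *s e j" and inj: "inj_on t {..<n}"
    and A: "A \<in> End scale"
  shows "zero_diagonal_space scale A T \<noteq> {\<lambda>x. 0} \<longleftrightarrow>
    (\<exists>p q r s. (\<lambda>x. p *s x + q *s T x + r *s A x + s *s A (T x)) \<noteq> (\<lambda>x. 0) \<and>
      (\<forall>i<n. p + q * t i + (r + s * t i) * c i (A (e i)) = 0))"
proof -
  note prim = primitive_idempotent_iff[OF T inj]
  define X where "X p q r s = (\<lambda>x. p *s x + q *s T x + r *s A x + s *s A (T x))" for p q r s
  have lin: "X p q r s \<in> End scale" for p q r s
    unfolding X_def by (rule EndI)
      (simp_all add: End_add[OF T(1)] End_add[OF A] End_scale[OF T(1)] End_scale[OF A] algebra_simps)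
  have d: "c i (X p q r s (e i)) = p + q * t i + (r + s * t i) * c i (A (e i))" if "i < n" for p q r s i
    unfolding X_def using that by (simp add: T(2) End_scale[OF A] c_linear c_e algebra_simps)
  have vanish: "(\<lambda>x. c i x *s e i) \<circ> X p q r s \<circ> (\<lambda>x. c i x *s e i) = (\<lambda>x. 0) \<longleftrightarrow>
      p + q * t i + (r + s * t i) * c i (A (e i)) = 0" if i: "i < n" for p q r s i
  proof -
    have 1: "(\<lambda>x. c i x *s e i) \<circ> X p q r s \<circ> (\<lambda>x. c i x *s e i) =
        (\<lambda>x. (c i x * c i (X p q r s (e i))) *s e i)"
      by (rule ext) (simp add: End_scale[OF lin] c_scale)
    have "(\<lambda>x. (c i x * c i (X p q r s (e i))) *s e i) = (\<lambda>x. 0) \<longleftrightarrow> c i (X p q r s (e i)) = 0"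
    proof
      assume "(\<lambda>x. (c i x * c i (X p q r s (e i))) *s e i) = (\<lambda>x. 0)"
      from fun_cong[OF this, of "e i"] show "c i (X p q r s (e i)) = 0"
        using e_nonzero[OF i] i by (simp add: c_e)
    qed simp
    then show ?thesis by (simp only: 1 d[OF i])
  qed
  have mem: "Y \<in> zero_diagonal_space scale A T \<longleftrightarrow>
    (\<exists>p q r s. Y = X p q r s \<and> (\<forall>i<n. p + q * t i + (r + s * t i) * c i (A (e i)) = 0))" for Y
  proof -
    have "(\<forall>E. primitive_idempotent scale T E \<longrightarrow> E \<circ> X p q r s \<circ> E = (\<lambda>v. 0)) \<longleftrightarrow>
        (\<forall>i<n. p + q * t i + (r + s * t i) * c i (A (e i)) = 0)" for p q r s
    proof (intro iffI allI impI)
      fix i assume *: "\<forall>E. primitive_idempotent scale T E \<longrightarrow> E \<circ> X p q r s \<circ> E = (\<lambda>v. 0)" and i: "i < n"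
      have "primitive_idempotent scale T (\<lambda>x. c i x *s e i)" using prim i by blast
      then show "p + q * t i + (r + s * t i) * c i (A (e i)) = 0" using * vanish[OF i] by blast
    next
      fix E assume *: "\<forall>i<n. p + q * t i + (r + s * t i) * c i (A (e i)) = 0"
        and "primitive_idempotent scale T E"
      then obtain i where i: "i < n" "E = (\<lambda>x. c i x *s e i)" using prim by blast
      show "E \<circ> X p q r s \<circ> E = (\<lambda>v. 0)"
        unfolding i(2) using * vanish[OF i(1)] i(1) by blast
    qed
    moreover have "Y \<in> zero_diagonal_space scale A T \<longleftrightarrow> (\<exists>p q r s. Y = X p q r s) \<and>
        (\<forall>E. primitive_idempotent scale T E \<longrightarrow> E \<circ> Y \<circ> E = (\<lambda>v. 0))"
      by (simp only: zero_diagonal_space_def X_def mem_Collect_eq)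
    ultimately show ?thesis by blast
  qed
  have "(\<lambda>x. 0) = X 0 0 0 0" by (simp add: X_def)
  moreover have "X 0 0 0 0 \<in> zero_diagonal_space scale A T"
    unfolding mem by (intro exI[of _ 0]) simp
  ultimately have "zero_diagonal_space scale A T \<noteq> {\<lambda>x. 0} \<longleftrightarrow>
      (\<exists>Y \<in> zero_diagonal_space scale A T. Y \<noteq> (\<lambda>x. 0))" by auto
  also have "\<dots> \<longleftrightarrow> (\<exists>p q r s. X p q r s \<noteq> (\<lambda>x. 0) \<and>
      (\<forall>i<n. p + q * t i + (r + s * t i) * c i (A (e i)) = 0))"
    unfolding Bex_def mem by blast
  finally show ?thesis by (simp only: X_def)
qed

end

lemma coords_of_ordered_basis:
  assumes "vector_space scale" "ordered_basis scale e"
  shows "coords scale (dimV scale) e (\<lambda>i x. module.representation scale (e ` {..<dimV scale}) x (e i))"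
proof -
  interpret vector_space scale by fact
  let ?B = "e ` {..<dimV scale}"
  have inj: "inj_on e {..<dimV scale}" and ind: "independent ?B" and sp: "span ?B = UNIV"
    using assms(2) by (auto simp: ordered_basis_def)
  show ?thesis
  proof
    show "(\<Sum>i<dimV scale. scale (representation ?B x (e i)) (e i)) = x" for x
      using sum_representation_eq[OF ind, of x ?B] sp by (simp add: sum.reindex[OF inj])
    show "representation ?B (e j) (e i) = (if i = j then 1 else 0)"
      if "i < dimV scale" "j < dimV scale" for i j
      using that inj by (auto simp: representation_basis[OF ind] dest: inj_onD)
  qed (simp_all add: representation_add[OF ind] representation_scale[OF ind] sp)
qed

section \<open>Self-dual pairs\<close>

lemma sum_single_index:
  fixes f :: "nat \<Rightarrow> 'a::comm_monoid_add"
  assumes "k < n" "\<And>i. i < n \<Longrightarrow> i \<noteq> k \<Longrightarrow> f i = 0"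
  shows "(\<Sum>i<n. f i) = f k"
proof -
  have "(\<Sum>i<n. f i) = (\<Sum>i<n. if i = k then f k else 0)"
    by (rule sum.cong) (use assms(2) in auto)
  then show ?thesis using assms(1) by simp
qed

text \<open>One half of a Leonard pair; \<open>leonard_coords\<close> combines two instances with
  the bases exchanged.\<close>

locale tridiag_diag =
  T: coords scale n t ct + D: coords scale n e ce
  for scale :: "'f::field \<Rightarrow> 'v::ab_group_add \<Rightarrow> 'v" (infixr "*s" 75)
    and n :: nat and t ct e ce +
  fixes A :: "'v \<Rightarrow> 'v" and th :: "nat \<Rightarrow> 'f"
  assumes A: "A \<in> End scale"
    and A_e: "j < n \<Longrightarrow> A (e j) = th j *s e j"
    and tri: "i < n \<Longrightarrow> j < n \<Longrightarrow> i + 1 < j \<or> j + 1 < i \<Longrightarrow> ct i (A (t j)) = 0"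
    and irred: "i + 1 < n \<Longrightarrow> ct i (A (t (i + 1))) \<noteq> 0" "i + 1 < n \<Longrightarrow> ct (i + 1) (A (t i)) \<noteq> 0"
    and n_pos: "0 < n"
begin

lemmas ce_A = D.c_eigenbasis[OF A A_e]

text \<open>Evaluating \<open>\<phi> (A (t k))\<close> gives a three-term recurrence in which
  \<open>\<phi> (t (k + 1))\<close> has a nonzero coefficient, so \<open>\<phi>\<close> is
  determined by its value at \<open>t 0\<close>.\<close>

lemma left_eigenfunctional_eq_0:
  fixes \<phi> :: "'v \<Rightarrow> 'f"
  assumes \<phi>: "\<And>x y. \<phi> (x + y) = \<phi> x + \<phi> y" "\<And>a x. \<phi> (a *s x) = a * \<phi> x"
    and eig: "\<And>x. \<phi> (A x) = \<theta> * \<phi> x" and 0: "\<phi> (t 0) = 0"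
  shows "\<phi> x = 0"
proof -
  have "j < n \<Longrightarrow> \<phi> (t j) = 0" for j
  proof (induction j rule: less_induct)
    case (less j)
    show ?case
    proof (cases j)
      case 0
      then show ?thesis using assms(4) by simp
    next
      case (Suc k)
      have "\<phi> (A (t k)) = (\<Sum>i<n. ct i (A (t k)) * \<phi> (t i))"
        by (rule T.functional_expand[OF \<phi>])
      also have "\<dots> = ct j (A (t k)) * \<phi> (t j)"
        by (rule sum_single_index[OF less.prems], use less Suc tri[of _ k] in force)
      finally have "ct j (A (t k)) * \<phi> (t j) = \<theta> * \<phi> (t k)"
        by (simp add: eig)
      moreover have "\<phi> (t k) = 0" using less Suc by simp
      moreover have "ct j (A (t k)) \<noteq> 0" using irred(2)[of k] less.prems Suc by simp
      ultimately show ?thesis by auto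
    qed
  qed
  then show ?thesis by (subst T.functional_expand[OF \<phi>]) simp
qed

text \<open>Each \<open>ce i\<close> is a nonzero left eigenfunctional of \<open>A\<close>. Thus
  \<open>t 0\<close> has a component in every eigenspace, and an operator diagonal in
  \<open>e\<close> can be recovered from its value at \<open>t 0\<close>.\<close>

lemma ce_t0_nonzero:
  assumes "i < n"
  shows "ce i (t 0) \<noteq> 0"
proof
  assume "ce i (t 0) = 0"
  then have "ce i (e i) = 0"
    by (rule left_eigenfunctional_eq_0[where \<theta> = "th i", rotated 3]) (simp_all add: D.c_linear ce_A assms)
  then show False using assms by (simp add: D.c_e)
qed

text \<open>For equal eigenvalues, the combination of two coordinate functionals that vanishes at
  \<open>t 0\<close> would be zero everywhere, but it is nonzero at \<open>e i\<close>.\<close>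

lemma inj_th: "inj_on th {..<n}"
proof (rule inj_onI)
  fix i j assume i: "i \<in> {..<n}" and j: "j \<in> {..<n}" and eq: "th i = th j"
  show "i = j"
  proof (rule ccontr)
    assume ne: "i \<noteq> j"
    define \<phi> where "\<phi> x = ce j (t 0) * ce i x - ce i (t 0) * ce j x" for x
    have "\<phi> (e i) = 0"
      by (rule left_eigenfunctional_eq_0[where \<theta> = "th i"])
        (use i j in \<open>simp_all add: \<phi>_def D.c_linear ce_A eq algebra_simps\<close>)
    then show False using i j ne ce_t0_nonzero[of j] by (simp add: \<phi>_def D.c_e)
  qed
qed

lemma th_eq_iff: "i < n \<Longrightarrow> j < n \<Longrightarrow> th i = th j \<longleftrightarrow> i = j"
  using inj_th by (auto dest: inj_onD)

lemma ct_A_support: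
  assumes "\<And>i. k \<le> i \<Longrightarrow> i < n \<Longrightarrow> ct i x = 0"
  shows "Suc k \<le> i \<Longrightarrow> i < n \<Longrightarrow> ct i (A x) = 0"
    and "k < n \<Longrightarrow> 0 < k \<Longrightarrow> ct k (A x) = ct (k - 1) x * ct k (A (t (k - 1)))"
proof -
  show "ct i (A x) = 0" if "Suc k \<le> i" "i < n"
    by (subst T.c_End[OF A], rule sum.neutral) (use assms that tri[of i] in force)
  show "ct k (A x) = ct (k - 1) x * ct k (A (t (k - 1)))" if "k < n" "0 < k"
    by (subst T.c_End[OF A], rule sum_single_index) (use assms that tri[of k] in force)+
qed

lemma ct_A_power:
  shows "Suc k \<le> i \<Longrightarrow> i < n \<Longrightarrow> ct i ((A ^^ k) (t 0)) = 0"
    and "k < n \<Longrightarrow> ct k ((A ^^ k) (t 0)) \<noteq> 0"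
proof (induction k arbitrary: i)
  case 0
  {
    case 1
    then show ?case by (simp add: T.c_e)
  next
    case 2
    then show ?case by (simp add: T.c_e)
  }
next
  case (Suc k)
  {
    case 1
    then show ?case using ct_A_support(1)[of "Suc k" "(A ^^ k) (t 0)" i] Suc.IH(1) by simp
  next
    case 2
    have "ct (Suc k) (A ((A ^^ k) (t 0))) = ct k ((A ^^ k) (t 0)) * ct (Suc k) (A (t k))"
      using ct_A_support(2)[of "Suc k" "(A ^^ k) (t 0)"] Suc.IH(1) 2 by simp
    then show ?case using Suc.IH(2) irred(2)[of k] 2 by simp
  }
qed

lemma ce_A_power: "i < n \<Longrightarrow> ce i ((A ^^ k) x) = th i ^ k * ce i x"
  by (induction k) (simp_all add: ce_A)

text \<open>The vector \<open>(A ^^ m) (t 0)\<close> has its last nonzero coordinate at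
  \<open>m\<close>, so a vector supported below \<open>k\<close> equals \<open>f(A) (t 0)\<close>
  with \<open>f\<close> of degree below \<open>k\<close>. In the basis \<open>e\<close>,
  \<open>f(A)\<close> multiplies the \<open>j\<close>-th coordinate by
  \<open>f(th j)\<close>.\<close>

lemma polynomial_on_spectrum:
  assumes "\<And>i. k \<le> i \<Longrightarrow> i < n \<Longrightarrow> ct i x = 0"
  shows "\<exists>f. \<forall>j<n. ce j x = (\<Sum>m<k. f m * th j ^ m) * ce j (t 0)"
  using assms
proof (induction k arbitrary: x)
  case 0
  have "x = 0" by (rule T.coords_eqI) (simp add: 0 T.c_zero)
  then show ?case by (simp add: D.c_zero)
next
  case (Suc k)
  \<comment> \<open>This coefficient cancels coordinate \<open>k\<close>; for
    \<open>k \<ge> n\<close> there is nothing to cancel and it is 0.\<close>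
  define a where "a = (if k < n then ct k x / ct k ((A ^^ k) (t 0)) else 0)"
  define x' where "x' = x - a *s (A ^^ k) (t 0)"
  have "ct i x' = 0" if "k \<le> i" "i < n" for i
  proof (cases "i = k")
    case True
    then show ?thesis using that ct_A_power(2)[of k] by (simp add: x'_def a_def T.c_linear)
  next
    case False
    then show ?thesis using that Suc.prems[of i] ct_A_power(1)[of k i] by (simp add: x'_def T.c_linear)
  qed
  from Suc.IH[OF this] obtain f where f: "ce j x' = (\<Sum>m<k. f m * th j ^ m) * ce j (t 0)" if "j < n" for j
    by blast
  have "ce j x = (\<Sum>m<Suc k. (f(k := a)) m * th j ^ m) * ce j (t 0)" if j: "j < n" for j
  proof -
    have "ce j x = ce j x' + a * th j ^ k * ce j (t 0)"
      by (simp add: x'_def D.c_linear ce_A_power[OF j])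
    then show ?thesis by (simp add: f[OF j] algebra_simps)
  qed
  then show ?case by blast
qed

end

section \<open>Eigenvalues and diagonal entries of a self-dual pair\<close>

text \<open>The duality appears only through its effect on matrices: both operators share the
  eigenvalues \<open>th\<close>, and each has the matrix \<open>M\<close> in the eigenbasis of the
  other.\<close>

locale self_dual_pair = tridiag_diag scale n t ct e ce A th
  for scale :: "'f::field \<Rightarrow> 'v::ab_group_add \<Rightarrow> 'v" (infixr "*s" 75)
    and n t ct e ce A th +
  fixes As :: "'v \<Rightarrow> 'v" and M :: "nat \<Rightarrow> nat \<Rightarrow> 'f"
  assumes As: "As \<in> End scale"
    and As_t: "j < n \<Longrightarrow> As (t j) = th j *s t j"
    and ct_A: "i < n \<Longrightarrow> j < n \<Longrightarrow> ct i (A (t j)) = M i j"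
    and ce_As: "i < n \<Longrightarrow> j < n \<Longrightarrow> ce i (As (e j)) = M i j"
    and n_ge_4: "n \<ge> 4"
begin

lemmas ct_As = T.c_eigenbasis[OF As As_t]

lemmas End_simps = T.End_zero[OF A] T.End_add[OF A] T.End_diff[OF A] T.End_scale[OF A]
  T.End_zero[OF As] T.End_add[OF As] T.End_diff[OF As] T.End_scale[OF As]

lemma M_tri: "i < n \<Longrightarrow> j < n \<Longrightarrow> i + 1 < j \<or> j + 1 < i \<Longrightarrow> M i j = 0"
  using tri ct_A by metis

lemma M_irred: "i + 1 < n \<Longrightarrow> M i (i + 1) \<noteq> 0" "i + 1 < n \<Longrightarrow> M (i + 1) i \<noteq> 0"
  using irred ct_A by (metis add_lessD1)+

lemma tri_cases:
  assumes "i < n" "j < n" "M i j \<noteq> 0"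
  obtains "i = j" | "i = j + 1" | "j = i + 1"
  using M_tri[of i j] assms by fastforce

text \<open>The commutator \<open>A\<^sup>2A\<^sup>*A - AA\<^sup>*A\<^sup>2\<close> equals \<open>[Y, A\<^sup>*]\<close> for some \<open>Y\<close> diagonal in \<open>e\<close>; looking at \<open>t 0\<close>,
  \<open>Y\<close> must be a polynomial of degree at most 3 in \<open>A\<close>.\<close>

lemma eigenvalue_cubic:
  obtains f3 f2 f1 where "\<And>i. i + 1 < n \<Longrightarrow>
    f3 * (th (i + 1)^2 + th (i + 1) * th i + th i^2) + f2 * (th i + th (i + 1)) + f1
      = th i * th (i + 1)"
proof -
  \<comment> \<open>In the basis \<open>e\<close> the \<open>(i, j)\<close> entry of the commutator
    is \<open>th i * th j * (th i - th j) * M i j\<close>, and that of \<open>[Y, As]\<close> is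
    \<open>(y i - y j) * M i j\<close>. The increments of \<open>y\<close> make them agree next to
    the diagonal.\<close>
  define y where "y j = (\<Sum>i<j. th (i + 1) * th i * (th (i + 1) - th i))" for j
  define Y where "Y = D.diag y"
  have Y: "Y \<in> End scale" and cY: "i < n \<Longrightarrow> ce i (Y x) = y i * ce i x"
    and Ye: "i < n \<Longrightarrow> Y (e i) = y i *s e i" for i x
    unfolding Y_def by (auto simp: D.diag_End D.c_diag D.diag_e)
  have comm: "Y (As x) - As (Y x) = A (A (As (A x))) - A (As (A (A x)))" for x
  proof (rule D.End_eqI[of "\<lambda>x. Y (As x) - As (Y x)" "\<lambda>x. A (A (As (A x))) - A (As (A (A x)))"])
    show "(\<lambda>x. Y (As x) - As (Y x)) \<in> End scale"
      by (rule T.EndI) (simp_all add: End_simps T.End_add[OF Y] T.End_scale[OF Y] algebra_simps)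
    show "(\<lambda>x. A (A (As (A x))) - A (As (A (A x)))) \<in> End scale"
      by (rule T.EndI) (simp_all add: End_simps algebra_simps)
    fix i j assume i: "i < n" and j: "j < n"
    have "(y i - y j) * M i j = th i * th j * (th i - th j) * M i j"
    proof (cases "M i j = 0")
      case False
      with i j show ?thesis by (cases rule: tri_cases) (auto simp: y_def algebra_simps)
    qed simp
    then show "ce i (Y (As (e j)) - As (Y (e j))) = ce i (A (A (As (A (e j)))) - A (As (A (A (e j)))))"
      using i j by (simp add: D.c_linear cY Ye ce_A A_e End_simps ce_As algebra_simps)
  qed
  have v0: "ct i (t 0) = 0" if "1 \<le> i" "i < n" for i
    using that by (simp add: T.c_e)
  have supp: "ct i (As x) = 0" if "\<And>i. k \<le> i \<Longrightarrow> i < n \<Longrightarrow> ct i x = 0" "k \<le> i" "i < n" for k i x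
    using that by (simp add: ct_As)
  \<comment> \<open>Three applications of \<open>A\<close> take \<open>t 0\<close> no further than
    \<open>t 3\<close>, while the \<open>i\<close>-th coordinate of \<open>[Y, As] (t 0)\<close> is
    \<open>th 0 - th i\<close> times that of \<open>Y (t 0)\<close>.\<close>
  have "ct i (Y (t 0)) = 0" if i: "4 \<le> i" "i < n" for i
  proof -
    note 1 = ct_A_support(1)[of 1, OF v0]
    note 2 = ct_A_support(1)[OF 1]
    note 3 = ct_A_support(1)[OF supp[OF 1]]
    have "ct i (Y (As (t 0)) - As (Y (t 0))) = 0"
      unfolding comm using i ct_A_support(1)[OF 3] ct_A_support(1)[OF supp[OF 2]]
      by (simp add: T.c_linear)
    then have "(th 0 - th i) * ct i (Y (t 0)) = 0"
      using i n_pos by (simp add: As_t T.End_scale[OF Y] T.c_linear ct_As algebra_simps)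
    then show ?thesis using i n_pos by (simp add: th_eq_iff)
  qed
  from polynomial_on_spectrum[OF this] obtain f
    where f: "ce j (Y (t 0)) = (\<Sum>m<4. f m * th j ^ m) * ce j (t 0)" if "j < n" for j by blast
  have f: "y j = f 0 + f 1 * th j + f 2 * th j^2 + f 3 * th j^3" if j: "j < n" for j
  proof -
    have "y j = (\<Sum>m<4. f m * th j ^ m)" using f[OF j] ce_t0_nonzero[OF j] by (simp add: cY j)
    then show ?thesis by (simp add: eval_nat_numeral algebra_simps)
  qed
  show thesis
  proof (rule that[of "f 3" "f 2" "f 1"])
    fix i assume i: "i + 1 < n"
    define s where "s = th i"
    define r where "r = th (i + 1)"
    have "y (i + 1) - y i = r * s * (r - s)" by (simp add: y_def r_def s_def)
    moreover have "y (i + 1) = f 0 + f 1 * r + f 2 * r^2 + f 3 * r^3" "y i = f 0 + f 1 * s + f 2 * s^2 + f 3 * s^3"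
      using f i by (simp_all add: r_def s_def)
    ultimately have "(r - s) * (f 3 * (r^2 + r * s + s^2) + f 2 * (s + r) + f 1 - s * r) = 0"
      by algebra
    moreover have "r \<noteq> s" using i by (simp add: r_def s_def th_eq_iff)
    ultimately show "f 3 * (th (i + 1)^2 + th (i + 1) * th i + th i^2) + f 2 * (th i + th (i + 1)) + f 1
      = th i * th (i + 1)" unfolding r_def[symmetric] s_def[symmetric] by auto
  qed
qed

lemma eigenvalue_curve:
  obtains \<beta> \<gamma> \<rho> where "\<And>i. i + 1 < n \<Longrightarrow>
    th i^2 + th (i + 1)^2 - \<beta> * th i * th (i + 1) - \<gamma> * (th i + th (i + 1)) - \<rho> = 0"
proof -
  obtain f3 f2 f1 where f: "\<And>i. i + 1 < n \<Longrightarrow>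
    f3 * (th (i + 1)^2 + th (i + 1) * th i + th i^2) + f2 * (th i + th (i + 1)) + f1 = th i * th (i + 1)"
    using eigenvalue_cubic by blast
  \<comment> \<open>Otherwise subtracting consecutive relations forces \<open>f2\<close> to equal
    both \<open>th 1\<close> and \<open>th 2\<close>; this uses four distinct eigenvalues.\<close>
  have "f3 \<noteq> 0"
  proof
    assume f3: "f3 = 0"
    have f': "f2 * (th i + th (i + 1)) + f1 = th i * th (i + 1)" if "i + 1 < n" for i
      using f[OF that] f3 by simp
    have "f2 * (th 0 + th 1) + f1 = th 0 * th 1" "f2 * (th 1 + th 2) + f1 = th 1 * th 2"
      "f2 * (th 2 + th 3) + f1 = th 2 * th 3"
      using f'[of 0] f'[of 1] f'[of 2] n_ge_4 by (simp_all add: eval_nat_numeral)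
    then have "(th 0 - th 2) * (f2 - th 1) = 0" "(th 1 - th 3) * (f2 - th 2) = 0"
      by algebra+
    then have "th 1 = th 2" using n_ge_4 by (simp add: th_eq_iff)
    then show False using n_ge_4 by (simp add: th_eq_iff)
  qed
  show thesis
  proof (rule that[of "(1 - f3) / f3" "- f2 / f3" "- f1 / f3"])
    fix i assume i: "i + 1 < n"
    define s where "s = th i"
    define r where "r = th (i + 1)"
    have "f3 * (r^2 + r * s + s^2) + f2 * (s + r) + f1 = s * r" using f[OF i] by (simp add: r_def s_def)
    moreover have "f3 * ((1 - f3) / f3) = 1 - f3" "f3 * (- f2 / f3) = - f2" "f3 * (- f1 / f3) = - f1"
      using \<open>f3 \<noteq> 0\<close> by auto
    ultimately have "f3 * (s^2 + r^2 - (1 - f3) / f3 * s * r - - f2 / f3 * (s + r) - - f1 / f3) = 0"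
      by algebra
    then show "th i^2 + th (i + 1)^2 - (1 - f3) / f3 * th i * th (i + 1) - - f2 / f3 * (th i + th (i + 1)) - - f1 / f3 = 0"
      using \<open>f3 \<noteq> 0\<close> by (simp add: r_def s_def)
  qed
qed

text \<open>The inequality comes from the \<open>(0, 0)\<close> entry of the Askey-Wilson relation, because
  \<open>M 0 1 * M 1 0 * (th 0 - th 2)\<close> is nonzero.\<close>

lemma askey_wilson_diagonal:
  assumes curve: "\<And>i. i + 1 < n \<Longrightarrow>
    th i^2 + th (i + 1)^2 - \<beta> * th i * th (i + 1) - \<gamma> * (th i + th (i + 1)) - \<rho> = 0"
  obtains \<omega> \<eta> where
    "\<And>i. i < n \<Longrightarrow> M i i * ((2 - \<beta>) * th i^2 - 2 * \<gamma> * th i - \<rho>) = \<gamma> * th i^2 + \<omega> * th i + \<eta>"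
    "\<omega> - \<rho> + \<gamma> * (M 0 0 + th 0) - (2 - \<beta>) * th 0 * M 0 0 \<noteq> 0"
proof -
  \<comment> \<open>The Askey-Wilson expression. Its \<open>(i, j)\<close> entry in the basis
    \<open>e\<close> is \<open>M i j\<close> times the curve polynomial at \<open>th i\<close>,
    \<open>th j\<close>, hence zero off the diagonal.\<close>
  define X where "X x = A (A (As x)) - \<beta> *s A (As (A x)) + As (A (A x))
    - \<gamma> *s (A (As x) + As (A x)) - \<rho> *s As x" for x
  have X: "X \<in> End scale"
    by (rule T.EndI) (simp_all add: X_def End_simps algebra_simps)
  define P where "P s = (2 - \<beta>) * s^2 - 2 * \<gamma> * s - \<rho>" for s
  have entry: "ce i (X (e j)) = (if i = j then M j j * P (th j) else 0)" if i: "i < n" and j: "j < n" for i j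
  proof -
    have 1: "ce i (X (e j)) = M i j * (th i^2 + th j^2 - \<beta> * th i * th j - \<gamma> * (th i + th j) - \<rho>)"
      unfolding X_def using i j
      by (simp add: D.c_linear ce_A A_e End_simps ce_As algebra_simps power2_eq_square)
    show ?thesis
    proof (cases "i = j")
      case True
      then show ?thesis using 1 by (simp add: P_def algebra_simps power2_eq_square)
    next
      case ne: False
      have "M i j = 0 \<or> th i^2 + th j^2 - \<beta> * th i * th j - \<gamma> * (th i + th j) - \<rho> = 0"
      proof (cases "M i j = 0")
        case False
        from i j False show ?thesis
        proof (cases rule: tri_cases)
          case 2
          then show ?thesis using curve[of j] i by (simp add: algebra_simps)
        next
          case 3
          then show ?thesis using curve[of i] j by simp
        qed (use ne in simp)
      qed simp
      then show ?thesis using ne by (simp only: 1 mult_eq_0_iff if_False)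
    qed
  qed
  have Xe: "X (e j) = (M j j * P (th j)) *s e j" if j: "j < n" for j
    by (rule D.coords_eqI) (use j in \<open>simp add: entry D.c_linear D.c_e\<close>)
  note cX = D.c_eigenbasis[OF X Xe]
  note One_nat_def [simp del]
  have lt: "0 < n" "1 < n" "2 < n" using n_ge_4 by auto
  have At0: "A (t 0) = M 0 0 *s t 0 + M 1 0 *s t 1"
    by (rule T.coords_eqI) (use lt M_tri[of _ 0] in \<open>auto simp: ct_A T.c_linear T.c_e\<close>)
  have At1: "A (t 1) = M 0 1 *s t 0 + M 1 1 *s t 1 + M 2 1 *s t 2"
    by (rule T.coords_eqI) (use lt M_tri[of _ 1] in \<open>auto simp: ct_A T.c_linear T.c_e\<close>)
  have "A (A (t 0)) = M 0 0 *s A (t 0) + M 1 0 *s A (t 1)"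
    using arg_cong[OF At0, of A] by (simp only: End_simps)
  then have AAt0: "A (A (t 0)) = (M 0 0^2 + M 0 1 * M 1 0) *s t 0 + (M 0 0 * M 1 0 + M 1 0 * M 1 1) *s t 1
      + (M 1 0 * M 2 1) *s t 2"
    unfolding At0 At1 by (simp add: algebra_simps power2_eq_square)
  have "A (As (A (t 0))) = (M 0 0 * th 0) *s A (t 0) + (M 1 0 * th 1) *s A (t 1)"
    using arg_cong[OF At0, of "\<lambda>x. A (As x)"] lt by (simp add: End_simps As_t)
  then have ABt0: "A (As (A (t 0))) = (th 0 * M 0 0^2 + th 1 * M 0 1 * M 1 0) *s t 0
      + (th 0 * M 0 0 * M 1 0 + th 1 * M 1 0 * M 1 1) *s t 1 + (th 1 * M 1 0 * M 2 1) *s t 2"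
    unfolding At0 At1 by (simp add: algebra_simps power2_eq_square)
  have ctX: "ct i (X (t 0)) = (th 0 + th i) * ct i (A (A (t 0))) - \<beta> * ct i (A (As (A (t 0))))
      - \<gamma> * (th 0 + th i) * ct i (A (t 0)) - \<rho> * th 0 * ct i (t 0)" if "i < n" for i
    using lt that by (simp add: X_def As_t End_simps T.c_linear ct_As algebra_simps)
  have X0: "ct 0 (X (t 0)) = 2 * th 0 * (M 0 0^2 + M 0 1 * M 1 0) - \<beta> * (th 0 * M 0 0^2 + th 1 * M 0 1 * M 1 0)
       - 2 * \<gamma> * th 0 * M 0 0 - \<rho> * th 0"
    unfolding ctX[OF lt(1)] AAt0 ABt0 unfolding At0
    using lt by (simp add: T.c_linear T.c_e algebra_simps)
  have X2: "ct 2 (X (t 0)) = M 1 0 * M 2 1 * (th 0 + th 2 - \<beta> * th 1)"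
    unfolding ctX[OF lt(3)] AAt0 ABt0 unfolding At0
    using lt by (simp add: T.c_linear T.c_e algebra_simps)
  \<comment> \<open>Since \<open>X (t 0)\<close> involves only \<open>t 0\<close>,
    \<open>t 1\<close>, \<open>t 2\<close> and \<open>X\<close> is diagonal in \<open>e\<close>,
    \<open>X\<close> is a polynomial of degree at most 2 in \<open>A\<close>; its coefficients are
    those of \<open>Q\<close>.\<close>
  have "ct i (X (t 0)) = 0" if "3 \<le> i" "i < n" for i
    unfolding ctX[OF that(2)] AAt0 ABt0 unfolding At0
    using that lt by (simp add: T.c_linear T.c_e)
  from polynomial_on_spectrum[OF this] obtain f
    where f: "ce j (X (t 0)) = (\<Sum>m<3. f m * th j ^ m) * ce j (t 0)" if "j < n" for j by blast
  have PQ: "M j j * P (th j) = f 0 + f 1 * th j + f 2 * th j^2" if j: "j < n" for j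
  proof -
    have "M j j * P (th j) = (\<Sum>m<3. f m * th j ^ m)" using f[OF j] ce_t0_nonzero[OF j] by (simp add: cX j)
    then show ?thesis by (simp add: One_nat_def eval_nat_numeral algebra_simps)
  qed
  have Xf: "X (t 0) = f 0 *s t 0 + f 1 *s A (t 0) + f 2 *s A (A (t 0))"
    by (rule D.coords_eqI) (simp add: cX PQ D.c_linear ce_A algebra_simps power2_eq_square)
  have "th 0^2 + th 1^2 - \<beta> * th 0 * th 1 - \<gamma> * (th 0 + th 1) - \<rho> = 0"
    "th 1^2 + th 2^2 - \<beta> * th 1 * th 2 - \<gamma> * (th 1 + th 2) - \<rho> = 0"
    using curve[of 0] curve[of 1] lt by simp_all
  \<comment> \<open>Subtracting two consecutive curve equations yields the three-term recurrence of
    the eigenvalues.\<close>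
  then have "(th 0 - th 2) * (th 0 + th 2 - \<beta> * th 1 - \<gamma>) = 0" by algebra
  then have "th 0 + th 2 - \<beta> * th 1 - \<gamma> = 0" using lt by (simp add: th_eq_iff)
  then have rec: "th 0 + th 2 = \<beta> * th 1 + \<gamma>" by algebra
  \<comment> \<open>The coefficient of \<open>t 2\<close> identifies the quadratic coefficient
    \<open>f 2\<close> as \<open>\<gamma>\<close>.\<close>
  have "ct 2 (X (t 0)) = M 1 0 * M 2 1 * \<gamma>"
    using X2 rec by algebra
  moreover have "ct 2 (X (t 0)) = f 2 * (M 1 0 * M 2 1)"
    unfolding Xf AAt0 by (use lt in \<open>simp add: At0 T.c_linear T.c_e\<close>)
  moreover have "M 1 0 * M 2 1 \<noteq> 0" using M_irred(2)[of 0] M_irred(2)[of 1] lt by simp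
  ultimately have f2: "f 2 = \<gamma>" by (metis mult.commute mult_cancel_left)
  have "ct 0 (X (t 0)) = f 0 + f 1 * M 0 0 + f 2 * (M 0 0^2 + M 0 1 * M 1 0)"
    unfolding Xf AAt0 by (use lt in \<open>simp add: At0 T.c_linear T.c_e\<close>)
  with X0 have eq0: "2 * th 0 * (M 0 0^2 + M 0 1 * M 1 0) - \<beta> * (th 0 * M 0 0^2 + th 1 * M 0 1 * M 1 0)
       - 2 * \<gamma> * th 0 * M 0 0 - \<rho> * th 0 = f 0 + f 1 * M 0 0 + \<gamma> * (M 0 0^2 + M 0 1 * M 1 0)"
    by (simp add: f2)
  \<comment> \<open>Eliminate \<open>f 0\<close> between \<open>eq0\<close> and the diagonal
    equation at \<open>th 0\<close>; then \<open>rec\<close> produces the factor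
    \<open>th 0 - th 2\<close>.\<close>
  have key: "M 0 1 * M 1 0 * (th 0 - th 2) =
      (M 0 0 - th 0) * (f 1 - \<rho> + \<gamma> * (M 0 0 + th 0) - (2 - \<beta>) * th 0 * M 0 0)"
    using eq0 PQ[OF lt(1)] rec unfolding f2 P_def by algebra
  show thesis
  proof (rule that[of "f 1" "f 0"])
    show "M i i * ((2 - \<beta>) * th i^2 - 2 * \<gamma> * th i - \<rho>) = \<gamma> * th i^2 + f 1 * th i + f 0" if "i < n" for i
      using PQ[OF that] by (simp add: P_def f2)
    have "M 0 1 * M 1 0 * (th 0 - th 2) \<noteq> 0"
      using M_irred[of 0] lt by (simp add: th_eq_iff)
    then show "f 1 - \<rho> + \<gamma> * (M 0 0 + th 0) - (2 - \<beta>) * th 0 * M 0 0 \<noteq> 0"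
      unfolding key by simp
  qed
qed

end

section \<open>Construction of the spin operators\<close>

context self_dual_pair
begin

text \<open>\<open>W\<close> and \<open>Ws\<close> are diagonal in \<open>e\<close> and
  \<open>t\<close> with the same weights \<open>w\<close>. The assumption on the diagonal gives
  \<open>B\<close> the diagonal of \<open>As\<close> in \<open>e\<close> and of \<open>A\<close> in
  \<open>t\<close>; the other one makes the factors at \<open>(i, i + 1)\<close> and
  \<open>(i + 1, i)\<close> mutually inverse, as conjugation by \<open>w\<close> requires.\<close>

lemma has_spin_if_parameters:
  assumes diag: "\<And>i. i < n \<Longrightarrow> x0 + x1 * th i + (x1 - 1 + (x3 + x4) * th i) * M i i = 0"
    and step: "\<And>i. i + 1 < n \<Longrightarrow>
      (x1 + x3 * th (i + 1) + x4 * th i) * (x1 + x3 * th i + x4 * th (i + 1)) = 1"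
  shows "has_spin scale A As"
proof -
  \<comment> \<open>The ratio \<open>w (k + 1) / w k\<close> is the factor by which the
    \<open>(k + 1, k)\<close> entries of \<open>B\<close> and \<open>As\<close> in \<open>e\<close>
    differ.\<close>
  define w where "w i = (\<Prod>k<i. x1 + x3 * th (k + 1) + x4 * th k)" for i
  have w_Suc: "w (i + 1) = w i * (x1 + x3 * th (i + 1) + x4 * th i)" for i
    by (simp add: w_def)
  have w_pred: "w i = w (i + 1) * (x1 + x3 * th i + x4 * th (i + 1))" if "i + 1 < n" for i
    using step[OF that] unfolding w_Suc by algebra
  have w_nz: "i < n \<Longrightarrow> w i \<noteq> 0" for i
  proof (induction i)
    case (Suc i)
    then show ?case using w_pred[of i] by auto
  qed (simp add: w_def)
  define W where "W = D.diag w"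
  define Ws where "Ws = T.diag w"
  define B where "B x = x0 *s x + x1 *s A x + x1 *s As x + x3 *s A (As x) + x4 *s As (A x)" for x
  have B: "B \<in> End scale" by (rule T.EndI) (simp_all add: B_def End_simps algebra_simps)
  have W: "W \<in> End scale" and cW: "i < n \<Longrightarrow> ce i (W x) = w i * ce i x"
    and We: "i < n \<Longrightarrow> W (e i) = w i *s e i" for i x
    by (auto simp: W_def D.diag_End D.c_diag D.diag_e)
  have Ws: "Ws \<in> End scale" and cWs: "i < n \<Longrightarrow> ct i (Ws x) = w i * ct i x"
    and Wst: "i < n \<Longrightarrow> Ws (t i) = w i *s t i" for i x
    by (auto simp: Ws_def T.diag_End T.c_diag T.diag_e)
  have WB: "(W \<circ> As) x = (B \<circ> W) x" for x
  proof (rule D.End_eqI[of "W \<circ> As" "B \<circ> W"])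
    fix i j assume i: "i < n" and j: "j < n"
    have "w i * M i j = w j * ((if i = j then x0 + x1 * th j else 0) + (x1 + x3 * th i + x4 * th j) * M i j)"
    proof (cases "M i j = 0")
      case True
      then show ?thesis using diag[OF j] by (auto simp: algebra_simps)
    next
      case False
      with i j show ?thesis
      proof (cases rule: tri_cases)
        case 1
        have "x0 + x1 * th j + (x1 + x3 * th j + x4 * th j) * M j j = M j j"
          using diag[OF j] by algebra
        then show ?thesis using 1 by simp
      next
        case 2
        show ?thesis unfolding 2 w_Suc by simp
      next
        case 3
        have "w i * M i j = (w j * (x1 + x3 * th i + x4 * th j)) * M i j"
          using w_pred[of i] j unfolding 3 by simp
        then show ?thesis using 3 by (simp add: algebra_simps)
      qed
    qed
    then show "ce i ((W \<circ> As) (e j)) = ce i ((B \<circ> W) (e j))"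
      using i j by (simp add: cW We T.End_scale[OF B] B_def End_simps D.c_linear D.c_e ce_A A_e ce_As algebra_simps)
  qed (simp_all add: T.End_comp W As B)
  \<comment> \<open>In the basis \<open>t\<close> the factors of \<open>B\<close> are transposed, so
    the same weights conjugate in the opposite direction.\<close>
  have WsB: "(A \<circ> Ws) x = (Ws \<circ> B) x" for x
  proof (rule T.End_eqI[of "A \<circ> Ws" "Ws \<circ> B"])
    fix i j assume i: "i < n" and j: "j < n"
    have "w j * M i j = w i * ((if i = j then x0 + x1 * th j else 0) + (x1 + x3 * th j + x4 * th i) * M i j)"
    proof (cases "M i j = 0")
      case True
      then show ?thesis using diag[OF j] by (auto simp: algebra_simps)
    next
      case False
      with i j show ?thesis
      proof (cases rule: tri_cases)
        case 1
        have "x0 + x1 * th j + (x1 + x3 * th j + x4 * th j) * M j j = M j j"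
          using diag[OF j] by algebra
        then show ?thesis using 1 by simp
      next
        case 2
        have "w j * M i j = (w i * (x1 + x3 * th j + x4 * th i)) * M i j"
          using w_pred[of j] i unfolding 2 by simp
        then show ?thesis using 2 by (simp add: algebra_simps)
      next
        case 3
        show ?thesis unfolding 3 w_Suc by simp
      qed
    qed
    then show "ct i ((A \<circ> Ws) (t j)) = ct i ((Ws \<circ> B) (t j))"
      using i j by (simp add: cWs Wst B_def End_simps T.c_linear T.c_e ct_As As_t ct_A algebra_simps)
  qed (simp_all add: T.End_comp Ws A B)
  have inv: "invertible_End scale W" "invertible_End scale Ws"
    unfolding W_def Ws_def using w_nz by (auto intro: D.invertible_diag T.invertible_diag)
  have WA: "(W \<circ> A) x = (A \<circ> W) x" for x
    by (rule D.End_eqI[of "W \<circ> A" "A \<circ> W"]) (simp_all add: T.End_comp W A cW ce_A We A_e End_simps D.c_linear D.c_e)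
  have WsAs: "(Ws \<circ> As) x = (As \<circ> Ws) x" for x
    by (rule T.End_eqI[of "Ws \<circ> As" "As \<circ> Ws"]) (simp_all add: T.End_comp Ws As cWs ct_As Wst As_t End_simps T.c_linear T.c_e)
  have "W \<circ> As \<circ> inv W = inv Ws \<circ> A \<circ> Ws"
  proof
    fix x
    have "surj W" "inj Ws" using inv by (auto simp: invertible_End_def bij_is_surj bij_is_inj)
    then show "(W \<circ> As \<circ> inv W) x = (inv Ws \<circ> A \<circ> Ws) x"
      using WB[of "inv W x"] WsB[of x] by (simp add: surj_f_inv_f inv_f_f)
  qed
  then show ?thesis
    unfolding has_spin_def using inv WA WsAs by blast
qed

end

lemma has_spin_if_zero_diagonal:
  fixes scale :: "'f::alg_closed_field \<Rightarrow> 'v::ab_group_add \<Rightarrow> 'v"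
  assumes "self_dual_pair scale n t ct e ce A th As M"
    and Z: "zero_diagonal_space scale A As \<noteq> {\<lambda>v. 0}"
  shows "has_spin scale A As"
proof -
  interpret self_dual_pair scale n t ct e ce A th As M by fact
  obtain p q r s where nz: "(\<lambda>x. scale p x + scale q (As x) + scale r (A x) + scale s (A (As x))) \<noteq> (\<lambda>x. 0)"
    and "\<forall>i<n. p + q * th i + (r + s * th i) * ct i (A (t i)) = 0"
    using iffD1[OF T.zero_diagonal_space_iff[OF As As_t inj_th A] Z] by blast
  then have zero: "p + q * th i + (r + s * th i) * M i i = 0" if "i < n" for i
    using that by (simp add: ct_A)
  have nz: "p \<noteq> 0 \<or> q \<noteq> 0 \<or> r \<noteq> 0 \<or> s \<noteq> 0"
    using nz by auto
  obtain \<beta> \<gamma> \<rho> where curve: "\<And>i. i + 1 < n \<Longrightarrow>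
      th i^2 + th (i + 1)^2 - \<beta> * th i * th (i + 1) - \<gamma> * (th i + th (i + 1)) - \<rho> = 0"
    using eigenvalue_curve by blast
  obtain \<omega> \<eta> where
    PQ: "\<And>i. i < n \<Longrightarrow> M i i * ((2 - \<beta>) * th i^2 - 2 * \<gamma> * th i - \<rho>) = \<gamma> * th i^2 + \<omega> * th i + \<eta>"
    and nondeg: "\<omega> - \<rho> + \<gamma> * (M 0 0 + th 0) - (2 - \<beta>) * th 0 * M 0 0 \<noteq> 0"
    using askey_wilson_diagonal[OF curve] by blast
  obtain x0 x1 x3 x4 where
    "\<And>i. i < n \<Longrightarrow> x0 + x1 * th i + (x1 - 1 + (x3 + x4) * th i) * M i i = 0"
    "\<And>i. i + 1 < n \<Longrightarrow>
      (x1 + x3 * th (i + 1) + x4 * th i) * (x1 + x3 * th i + x4 * th (i + 1)) = 1"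
    using spin_parameters[where a = "\<lambda>i. M i i", OF inj_th n_ge_4 curve PQ nondeg zero nz] by blast
  then show ?thesis by (rule has_spin_if_parameters)
qed

section \<open>Algebra automorphisms are inner\<close>

context coords
begin

lemma End_transitive:
  assumes "x \<noteq> 0"
  obtains X where "X \<in> End scale" "X x = z"
proof -
  obtain i where i: "c i x \<noteq> 0" using assms coords_eqI[of x 0] by (auto simp: c_zero)
  show thesis
  proof (rule that[of "\<lambda>w. (c i w / c i x) *s z"])
    show "(\<lambda>w. (c i w / c i x) *s z) \<in> End scale"
      by (rule EndI) (simp_all add: c_linear add_divide_distrib algebra_simps)
  qed (use i in simp)
qed

text \<open>Skolem-Noether: the inner map sends \<open>x\<close> to the value at a fixed vector of the image of a rank one map
  with range spanned by \<open>x\<close>.\<close>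

lemma End_algebra_iso_inner:
  assumes "End_algebra_iso scale \<sigma>" "0 < n"
  obtains T where "invertible_End scale T" "\<And>X x. X \<in> End scale \<Longrightarrow> \<sigma> X (T x) = T (X x)"
proof -
  have bij: "bij_betw \<sigma> (End scale) (End scale)"
    and add: "\<And>X Y. X \<in> End scale \<Longrightarrow> Y \<in> End scale \<Longrightarrow> \<sigma> (\<lambda>v. X v + Y v) = (\<lambda>v. \<sigma> X v + \<sigma> Y v)"
    and sc: "\<And>a X. X \<in> End scale \<Longrightarrow> \<sigma> (\<lambda>v. a *s X v) = (\<lambda>v. a *s \<sigma> X v)"
    and comp: "\<And>X Y. X \<in> End scale \<Longrightarrow> Y \<in> End scale \<Longrightarrow> \<sigma> (X \<circ> Y) = \<sigma> X \<circ> \<sigma> Y"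
    using assms(1) by (auto simp: End_algebra_iso_def)
  have \<sigma>_End: "X \<in> End scale \<Longrightarrow> \<sigma> X \<in> End scale" for X
    using bij by (auto simp: bij_betw_def)
  \<comment> \<open>The map \<open>R\<close> embeds \<open>V\<close> into \<open>End(V)\<close> as a
    left ideal, by \<open>X o R x = R (X x)\<close>.\<close>
  define R where "R x = (\<lambda>w. c 0 w *s x)" for x
  have R: "R x \<in> End scale" for x
    by (rule EndI) (simp_all add: R_def c_linear algebra_simps)
  have R_comp: "X \<circ> R x = R (X x)" if "X \<in> End scale" for X x
    by (auto simp: R_def End_scale[OF that])
  have R0: "R (e 0) (e 0) = e 0" using assms(2) by (simp add: R_def c_e)
  have z0: "(\<lambda>v. 0) \<in> End scale" by (rule EndI) simp_all
  have "\<sigma> (\<lambda>v. 0) = (\<lambda>v. 0)" using sc[OF z0, of 0] by simp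
  moreover have "R (e 0) \<noteq> (\<lambda>v. 0)" using R0 e_nonzero[OF assms(2)] by metis
  ultimately have "\<sigma> (R (e 0)) \<noteq> (\<lambda>v. 0)"
    using bij R z0 by (metis bij_betw_def inj_onD)
  then obtain z where z: "\<sigma> (R (e 0)) z \<noteq> 0" by auto
  \<comment> \<open>Idempotence of \<open>R (e 0)\<close> gives
    \<open>T (e 0) = \<sigma> (R (e 0)) z\<close>, which is nonzero by the choice of
    \<open>z\<close>.\<close>
  define T where "T x = \<sigma> (R x) (\<sigma> (R (e 0)) z)" for x
  have T_comm: "\<sigma> X (T x) = T (X x)" if "X \<in> End scale" for X x
    unfolding T_def by (simp add: R_comp[OF that, symmetric] comp[OF that R])
  have T: "T \<in> End scale"
  proof (rule EndI)
    show "T (x + y) = T x + T y" for x y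
    proof -
      have "R (x + y) = (\<lambda>w. R x w + R y w)" by (simp add: R_def algebra_simps)
      then show ?thesis by (simp add: T_def add[OF R R])
    qed
    show "T (a *s x) = a *s T x" for a x
    proof -
      have "R (a *s x) = (\<lambda>w. a *s R x w)" by (simp add: R_def algebra_simps)
      then show ?thesis by (simp add: T_def sc[OF R])
    qed
  qed
  have "T (e 0) = \<sigma> (R (e 0)) z"
    using comp[OF R R, of "e 0" "e 0"] R_comp[OF R, of "e 0" "e 0"] by (simp add: T_def R0 fun_eq_iff)
  then have T0: "T (e 0) \<noteq> 0" using z by simp
  \<comment> \<open>A nonzero kernel vector could be moved to \<open>e 0\<close> by some
    \<open>X\<close>, and \<open>\<sigma> X\<close> would send 0 to \<open>T (e 0)\<close>.\<close>
  have ker: "x = 0" if "T x = 0" for x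
  proof (rule ccontr)
    assume "x \<noteq> 0"
    then obtain X where X: "X \<in> End scale" "X x = e 0" using End_transitive by blast
    have "T (e 0) = \<sigma> X (T x)" using T_comm[OF X(1), of x] X(2) by simp
    also have "\<dots> = 0" using that End_zero[OF \<sigma>_End[OF X(1)]] by simp
    finally show False using T0 by simp
  qed
  have "inj T"
  proof (rule injI)
    fix x y assume "T x = T y"
    then have "T (x - y) = 0" by (simp add: End_diff[OF T])
    then have "x - y = 0" by (rule ker)
    then show "x = y" by simp
  qed
  moreover have "surj T"
  proof -
    have "\<exists>x. T x = y" for y
    proof -
      obtain Z where Z: "Z \<in> End scale" "Z (T (e 0)) = y" using End_transitive[OF T0] by blast
      then obtain X where "X \<in> End scale" "Z = \<sigma> X" using bij by (auto simp: bij_betw_def)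
      then show ?thesis using T_comm Z(2) by metis
    qed
    then show ?thesis by (metis surjI)
  qed
  ultimately have "invertible_End scale T" using T by (simp add: invertible_End_def bij_def)
  then show thesis using T_comm by (rule that)
qed

lemma coords_image:
  assumes "invertible_End scale T"
  shows "coords scale n (\<lambda>i. T (e i)) (\<lambda>i x. c i (inv T x))"
proof -
  have T: "T \<in> End scale" and b: "bij T" using assms by (auto simp: invertible_End_def)
  note Ti = End_inv[OF assms]
  show ?thesis
  proof
    show "(\<Sum>i<n. c i (inv T x) *s T (e i)) = x" for x
      using End_expand[OF T, of "inv T x"] b by (simp add: bij_is_surj surj_f_inv_f)
  qed (use b in \<open>simp_all add: End_add[OF Ti] End_scale[OF Ti] c_linear c_e bij_is_inj inv_f_f\<close>)
qed

text \<open>The inner map \<open>T\<close> carries \<open>e\<close> to an eigenbasis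
  \<open>t\<close> of \<open>As\<close> with the same eigenvalues, and the matrix of
  \<open>A\<close> in \<open>t\<close> is that of \<open>As\<close> in \<open>e\<close>.\<close>

lemma self_dual_pair_if_self_dual:
  assumes "self_dual scale A As" and n: "n \<ge> 4"
    and A: "A \<in> End scale" "\<And>j. j < n \<Longrightarrow> A (e j) = th j *s e j"
    and As: "As \<in> End scale"
      "\<And>i j. i < n \<Longrightarrow> j < n \<Longrightarrow> i + 1 < j \<or> j + 1 < i \<Longrightarrow> c i (As (e j)) = 0"
      "\<And>i. i + 1 < n \<Longrightarrow> c i (As (e (i + 1))) \<noteq> 0" "\<And>i. i + 1 < n \<Longrightarrow> c (i + 1) (As (e i)) \<noteq> 0"
  obtains t ct M where "self_dual_pair scale n t ct e c A th As M"
proof -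
  obtain \<sigma> where s: "End_algebra_iso scale \<sigma>" "\<sigma> A = As" "\<sigma> As = A"
    using assms(1) by (auto simp: self_dual_def leonard_pairs_isomorphic_def)
  obtain T where T: "invertible_End scale T" and comm: "\<And>X x. X \<in> End scale \<Longrightarrow> \<sigma> X (T x) = T (X x)"
    using End_algebra_iso_inner[OF s(1)] n by auto
  have AT: "As (T x) = T (A x)" "A (T x) = T (As x)" for x
    using comm[OF A(1), of x] comm[OF As(1), of x] s by simp_all
  have inv: "inv T (T x) = x" for x
    using T by (simp add: invertible_End_def bij_is_inj inv_f_f)
  have TE: "T \<in> End scale" using T by (simp add: invertible_End_def)
  have t: "coords scale n (\<lambda>i. T (e i)) (\<lambda>i x. c i (inv T x))" by (rule coords_image[OF T])
  have e: "coords scale n e c" by unfold_locales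
  have "self_dual_pair scale n (\<lambda>i. T (e i)) (\<lambda>i x. c i (inv T x)) e c A th As (\<lambda>i j. c i (As (e j)))"
    by (intro self_dual_pair.intro tridiag_diag.intro t e tridiag_diag_axioms.intro self_dual_pair_axioms.intro)
      (use n A As in \<open>simp_all add: AT inv End_scale[OF TE]\<close>)
  then show thesis by (rule that)
qed

end

section \<open>Spin pairs\<close>

lemma sum_superdiagonal_support:
  fixes f :: "nat \<Rightarrow> 'a::comm_monoid_add"
  assumes "i < n" "\<And>j. j < n \<Longrightarrow> j \<noteq> i \<Longrightarrow> j \<noteq> i + 1 \<Longrightarrow> f j = 0"
  shows "(\<Sum>j<n. f j) = f i + (if i + 1 < n then f (i + 1) else 0)"
proof -
  have "(\<Sum>j<n. f j) = (\<Sum>j<n. (if j = i then f i else 0) + (if j = i + 1 then f (i + 1) else 0))"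
    by (rule sum.cong) (use assms(2) in auto)
  also have "\<dots> = f i + (if i + 1 < n then f (i + 1) else 0)"
    using assms(1) by (simp add: sum.distrib)
  finally show ?thesis .
qed

text \<open>Once the earlier rows vanish, antisymmetry leaves only \<open>N i (i + 1)\<close> in row
  \<open>i\<close>, and the linear equation kills it.\<close>

lemma antisymmetric_tridiagonal_eq_0:
  fixes N :: "nat \<Rightarrow> nat \<Rightarrow> 'f::field"
  assumes "\<And>i j. i < n \<Longrightarrow> j < n \<Longrightarrow> i + 1 < j \<or> j + 1 < i \<Longrightarrow> N i j = 0"
    and "\<And>i. N i i = 0" "\<And>i j. N i j = - N j i"
    and "\<And>i. i < n \<Longrightarrow> (\<Sum>j<n. N i j * \<alpha> j) = 0" "\<And>i. i < n \<Longrightarrow> \<alpha> i \<noteq> 0"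
  shows "i < n \<Longrightarrow> \<forall>j<n. N i j = 0"
proof (induction i rule: less_induct)
  case (less i)
  have low: "N i j = 0" if "j < i" for j
    using less that assms(3)[of i j] by (metis minus_zero order.strict_trans)
  have "(\<Sum>j<n. N i j * \<alpha> j) = N i i * \<alpha> i + (if i + 1 < n then N i (i + 1) * \<alpha> (i + 1) else 0)"
    by (rule sum_superdiagonal_support) (use less low assms(1)[of i] in \<open>auto simp: nat_neq_iff\<close>)
  then have "N i (i + 1) = 0" if "i + 1 < n"
    using assms(2)[of i] assms(4)[of i] assms(5)[of "i + 1"] less.prems that by auto
  then show ?case
    using low assms(1)[of i] assms(2)[of i] less.prems by (metis Suc_eq_plus1 Suc_lessI nat_neq_iff)
qed

text \<open>Here row \<open>i\<close> retains two unknowns, \<open>m i i\<close> and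
  \<open>m i (i + 1)\<close>; the two equations are independent because \<open>th i\<close> and
  \<open>th (i + 1)\<close> differ.\<close>

lemma symmetric_tridiagonal_eq_0:
  fixes m :: "nat \<Rightarrow> nat \<Rightarrow> 'f::field"
  assumes "\<And>i j. i < n \<Longrightarrow> j < n \<Longrightarrow> i + 1 < j \<or> j + 1 < i \<Longrightarrow> m i j = 0"
    and "\<And>i j. m i j = m j i"
    and "\<And>i. i < n \<Longrightarrow> (\<Sum>j<n. m i j * \<alpha> j) = 0" "\<And>i. i < n \<Longrightarrow> \<alpha> i \<noteq> 0"
    and "\<And>i. i < n \<Longrightarrow> (\<Sum>j<n. m i j * (th j * \<alpha> j)) = 0" "inj_on th {..<n}"
  shows "i < n \<Longrightarrow> \<forall>j<n. m i j = 0"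
proof (induction i rule: less_induct)
  case (less i)
  have low: "m i j = 0" if "j < i" for j
    using less that assms(2)[of i j] by (metis order.strict_trans)
  have *: "(\<Sum>j<n. m i j * b j) = m i i * b i + (if i + 1 < n then m i (i + 1) * b (i + 1) else 0)" for b
    by (rule sum_superdiagonal_support) (use less low assms(1)[of i] in \<open>auto simp: nat_neq_iff\<close>)
  note eqs = assms(3,5)[OF less.prems, unfolded *]
  have up: "m i (i + 1) = 0" if i: "i + 1 < n"
  proof -
    have "m i (i + 1) * \<alpha> (i + 1) * (th (i + 1) - th i) = 0"
      using eqs i by simp algebra
    moreover have "th (i + 1) \<noteq> th i" using assms(6) i by (auto dest: inj_onD)
    ultimately show ?thesis using assms(4)[OF i] by simp
  qed
  then have "m i i = 0"
    using eqs(1) assms(4)[OF less.prems] by (auto split: if_splits)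
  then show ?case
    using low up assms(1)[of i] less.prems by (metis Suc_eq_plus1 Suc_lessI nat_neq_iff)
qed

section \<open>The invariant form and operators tridiagonal in both bases\<close>

locale leonard_coords =
  P: tridiag_diag scale n v cv u cu A th + Q: tridiag_diag scale n u cu v cv As ths
  for scale :: "'f::field \<Rightarrow> 'v::ab_group_add \<Rightarrow> 'v" (infixr "*s" 75)
    and n v cv u cu A th As ths
begin

lemmas End_simps = P.T.End_zero[OF P.A] P.T.End_add[OF P.A] P.T.End_diff[OF P.A] P.T.End_scale[OF P.A]
  P.T.End_zero[OF Q.A] P.T.End_add[OF Q.A] P.T.End_diff[OF Q.A] P.T.End_scale[OF Q.A]

text \<open>The weights make both operators self-adjoint for \<open>form\<close>.\<close>

primrec weight :: "nat \<Rightarrow> 'f" where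
  "weight 0 = 1"
| "weight (Suc i) = weight i * cv i (A (v (i + 1))) / cv (i + 1) (A (v i))"

definition form :: "'v \<Rightarrow> 'v \<Rightarrow> 'f" where
  "form x y = (\<Sum>i<n. weight i * cv i x * cv i y)"

lemma weight_nonzero: "i < n \<Longrightarrow> weight i \<noteq> 0"
  by (induction i) (use P.irred in auto)

lemma weight_symmetric:
  assumes "i < n" "j < n"
  shows "weight i * cv i (A (v j)) = weight j * cv j (A (v i))"
proof -
  have step: "weight (k + 1) * cv (k + 1) (A (v k)) = weight k * cv k (A (v (k + 1)))" if "k + 1 < n" for k
    using P.irred(2)[OF that] by simp
  consider "i = j" | "i = j + 1" | "j = i + 1" | "i + 1 < j \<or> j + 1 < i" by linarith
  then show ?thesis
  proof cases
    case 2
    then show ?thesis using step[of j] assms by simp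
  next
    case 3
    then show ?thesis using step[of i] assms by simp
  next
    case 4
    then have "cv i (A (v j)) = 0" "cv j (A (v i)) = 0" using assms P.tri by blast+
    then show ?thesis by simp
  qed simp
qed

lemma form_commute: "form x y = form y x"
  by (simp add: form_def mult.commute mult.left_commute)

lemma form_add: "form (x + y) z = form x z + form y z" "form z (x + y) = form z x + form z y"
  by (simp_all add: form_def P.T.c_linear algebra_simps sum.distrib)

lemma form_scale: "form (a *s x) z = a * form x z" "form z (a *s x) = a * form z x"
  by (simp_all add: form_def P.T.c_linear algebra_simps sum_distrib_left)

lemma form_v: "i < n \<Longrightarrow> form x (v i) = weight i * cv i x"
  by (simp add: form_def P.T.c_e sum_single_index[of i])

lemma form_A: "form (A x) y = form x (A y)"
proof -
  have "form (A x) y = (\<Sum>i<n. \<Sum>j<n. weight i * cv i (A (v j)) * cv j x * cv i y)"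
    by (simp add: form_def P.T.c_End[OF P.A, of _ x] sum_distrib_left sum_distrib_right algebra_simps)
  also have "\<dots> = (\<Sum>i<n. \<Sum>j<n. weight j * cv j (A (v i)) * cv j x * cv i y)"
    by (intro sum.cong refl) (simp add: weight_symmetric)
  also have "\<dots> = (\<Sum>j<n. \<Sum>i<n. weight j * cv j (A (v i)) * cv j x * cv i y)"
    by (rule sum.swap)
  also have "\<dots> = form x (A y)"
    by (simp add: form_def P.T.c_End[OF P.A, of _ y] sum_distrib_left algebra_simps)
  finally show ?thesis .
qed

lemma form_As: "form (As x) y = form x (As y)"
  by (simp add: form_def Q.ce_A algebra_simps)

lemma form_eqI:
  assumes "\<And>y. form x y = form x' y"
  shows "x = x'"
proof (rule P.T.coords_eqI)
  fix i assume "i < n"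
  then show "cv i x = cv i x'" using assms[of "v i"] weight_nonzero by (simp add: form_v)
qed

text \<open>Eigenvectors of the self-adjoint \<open>A\<close> for distinct eigenvalues are
  orthogonal.\<close>

lemma form_u:
  assumes "i < n"
  shows "form x (u i) = form (u i) (u i) * cu i x"
proof -
  have orth: "form (u j) (u i) = 0" if "j < n" "j \<noteq> i" for j
  proof -
    have "th j * form (u j) (u i) = th i * form (u j) (u i)"
      using form_A[of "u j" "u i"] that assms by (simp add: P.A_e form_scale)
    then show ?thesis using P.th_eq_iff that assms by auto
  qed
  have "form x (u i) = (\<Sum>j<n. cu j x * form (u j) (u i))"
    by (rule P.D.functional_expand) (simp_all add: form_add form_scale)
  also have "\<dots> = cu i x * form (u i) (u i)"
    by (rule sum_single_index[OF assms]) (simp add: orth)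
  finally show ?thesis by simp
qed

lemma form_u_nonzero:
  assumes "i < n"
  shows "form (u i) (u i) \<noteq> 0"
proof
  assume "form (u i) (u i) = 0"
  then have "form y (u i) = 0" for y using form_u[OF assms, of y] by simp
  then have "form (u i) y = form 0 y" for y
    using form_commute form_scale(1)[of 0 0 y] by (metis mult_zero_left P.T.scale_zero_left)
  then have "u i = 0" by (rule form_eqI)
  then show False using P.D.e_nonzero assms by blast
qed

lemma form_eqI_u:
  assumes "\<And>i. i < n \<Longrightarrow> form x (u i) = form x' (u i)"
  shows "x = x'"
proof (rule P.D.coords_eqI)
  fix i assume i: "i < n"
  have "form (u i) (u i) * cu i x = form (u i) (u i) * cu i x'"
    using assms[OF i] by (simp only: form_u[OF i, of x] form_u[OF i, of x'])
  then show "cu i x = cu i x'" using form_u_nonzero[OF i] by simp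
qed

text \<open>The antisymmetric part of \<open>X\<close> kills \<open>v 0\<close>, all of whose \<open>u\<close>-coordinates are nonzero, so \<open>X\<close> is
  self-adjoint; then \<open>X (v 0) = 0\<close> and \<open>X (A (v 0)) = 0\<close> kill its matrix row by row.\<close>

lemma bitridiagonal_eq_0:
  assumes X: "X \<in> End scale"
    and v: "\<And>i j. i < n \<Longrightarrow> j < n \<Longrightarrow> i + 1 < j \<or> j + 1 < i \<Longrightarrow> cv i (X (v j)) = 0"
    and u: "\<And>i j. i < n \<Longrightarrow> j < n \<Longrightarrow> i + 1 < j \<or> j + 1 < i \<Longrightarrow> cu i (X (u j)) = 0"
    and n: "1 < n" and Xv: "X (v 0) = 0" "X (v 1) = 0"
  shows "X x = 0"
proof -
  note X_simps = P.T.End_add[OF X] P.T.End_scale[OF X]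
  have form0: "form 0 y = 0" for y using form_scale(1)[of 0 0 y] by simp
  have expand_u: "form (X x) (u i) = (\<Sum>j<n. cu j x * form (X (u j)) (u i))" for x i
    by (rule P.D.functional_expand) (simp_all add: X_simps form_add form_scale)
  \<comment> \<open>The first row of \<open>X\<close> in the basis \<open>v\<close> vanishes, so the
    adjoint of \<open>X\<close> kills \<open>v 0\<close> as well.\<close>
  have row: "form (X y) (v 0) = 0" for y
  proof -
    have "cv 0 (X (v j)) = 0" if "j < n" for j
    proof -
      consider "j = 0" | "j = 1" | "1 < j" by linarith
      then show ?thesis using Xv v[of 0 j] n that by cases (auto simp: P.T.c_zero)
    qed
    then have "cv 0 (X y) = 0" by (simp add: P.T.c_End[OF X, of 0 y])
    then show ?thesis using n by (simp add: form_v)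
  qed
  have tri_u: "form (X (u j)) (u i) = 0" if "i < n" "j < n" "i + 1 < j \<or> j + 1 < i" for i j
    using u[OF that] form_u[OF that(1), of "X (u j)"] by simp
  have "\<forall>j<n. form (X (u j)) (u i) - form (X (u i)) (u j) = 0" if "i < n" for i
  proof (rule antisymmetric_tridiagonal_eq_0[where n = n
        and N = "\<lambda>i j. form (X (u j)) (u i) - form (X (u i)) (u j)" and \<alpha> = "\<lambda>j. cu j (v 0)"])
    fix i assume i: "i < n"
    have "(\<Sum>j<n. (form (X (u j)) (u i) - form (X (u i)) (u j)) * cu j (v 0)) =
        (\<Sum>j<n. cu j (v 0) * form (X (u j)) (u i)) - (\<Sum>j<n. cu j (v 0) * form (X (u i)) (u j))"
      by (simp add: sum_subtractf algebra_simps)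
    also have "(\<Sum>j<n. cu j (v 0) * form (X (u i)) (u j)) = form (X (u i)) (v 0)"
      by (rule P.D.functional_expand[symmetric]) (simp_all add: form_add form_scale)
    finally show "(\<Sum>j<n. (form (X (u j)) (u i) - form (X (u i)) (u j)) * cu j (v 0)) = 0"
      by (simp only: expand_u[symmetric] row Xv form0) simp
  qed (use tri_u P.ce_t0_nonzero that in auto)
  then have sym: "form (X (u j)) (u i) = form (X (u i)) (u j)" if "i < n" "j < n" for i j
    using that by simp
  have "X (A (v 0)) = 0"
  proof -
    have "X (A (v 0)) = (\<Sum>j<n. cv j (A (v 0)) *s X (v j))"
      by (rule P.T.End_expand[OF X])
    also have "\<dots> = 0"
    proof (rule sum.neutral, rule ballI)
      fix j assume j: "j \<in> {..<n}"
      consider "j = 0" | "j = 1" | "1 < j" by linarith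
      then show "cv j (A (v 0)) *s X (v j) = 0"
        using Xv P.tri[of j 0] n j by cases auto
    qed
    finally show ?thesis .
  qed
  \<comment> \<open>The cut-off to 0 outside the index range makes the symmetry hold for all
    indices.\<close>
  define m where "m i j = (if i < n \<and> j < n then form (X (u j)) (u i) else 0)" for i j
  have m_tri: "m i j = 0" if "i + 1 < j \<or> j + 1 < i" for i j
    using tri_u[OF _ _ that] unfolding m_def by presburger
  have m_sym: "m i j = m j i" for i j
    using sym[of i j] unfolding m_def by presburger
  have m0: "\<forall>j<n. m i j = 0" if "i < n" for i
  proof (rule symmetric_tridiagonal_eq_0[where n = n and m = m and \<alpha> = "\<lambda>j. cu j (v 0)" and th = th])
    fix i assume i: "i < n"
    show "(\<Sum>j<n. m i j * cu j (v 0)) = 0"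
      using expand_u[of "v 0" i] i by (simp add: m_def Xv form0 mult.commute)
    show "(\<Sum>j<n. m i j * (th j * cu j (v 0))) = 0"
      using expand_u[of "A (v 0)" i] i \<open>X (A (v 0)) = 0\<close> by (simp add: m_def form0 P.ce_A mult.commute)
  qed (rule P.inj_th that m_sym m_tri P.ce_t0_nonzero | assumption)+
  have 0: "form (X (u j)) (u i) = 0" if "i < n" "j < n" for i j
    using m0[OF that(1)] that unfolding m_def by presburger
  show ?thesis
  proof (rule form_eqI_u)
    fix i assume i: "i < n"
    have "(\<Sum>j<n. cu j x * form (X (u j)) (u i)) = 0"
      by (rule sum.neutral) (simp add: 0[OF i])
    then show "form (X x) (u i) = form 0 (u i)"
      by (simp only: expand_u[of x i] form0)
  qed
qed

text \<open>By \<open>bitridiagonal_eq_0\<close> it suffices to match \<open>X\<close> on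
  \<open>v 0\<close> and \<open>v 1\<close>. These have two and three possibly nonzero coordinates,
  which determine the five coefficients.\<close>

lemma bitridiagonal_span:
  assumes X: "X \<in> End scale"
    and v: "\<And>i j. i < n \<Longrightarrow> j < n \<Longrightarrow> i + 1 < j \<or> j + 1 < i \<Longrightarrow> cv i (X (v j)) = 0"
    and u: "\<And>i j. i < n \<Longrightarrow> j < n \<Longrightarrow> i + 1 < j \<or> j + 1 < i \<Longrightarrow> cu i (X (u j)) = 0"
    and n: "2 < n"
  obtains x0 x1 x2 x3 x4 where
    "\<And>x. X x = x0 *s x + x1 *s A x + x2 *s As x + x3 *s A (As x) + x4 *s As (A x)"
proof -
  note One_nat_def [simp del]
  have lt: "0 < n" "1 < n" "2 < n" using n by auto
  have ne: "ths 0 \<noteq> ths 1" "ths 0 \<noteq> ths 2" "ths 1 \<noteq> ths 2" using lt by (simp_all add: Q.th_eq_iff)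
  have irr: "cv 1 (A (v 0)) \<noteq> 0" "cv 0 (A (v 1)) \<noteq> 0" "cv 2 (A (v 1)) \<noteq> 0"
    using P.irred[of 0] P.irred(2)[of 1] lt by auto
  \<comment> \<open>Off the diagonal, the \<open>(i, j)\<close> entry of the candidate
    \<open>Y\<close> is \<open>x1 + x3 * ths j + x4 * ths i\<close> times that of \<open>A\<close>.
    The ratios at \<open>(1, 0)\<close>, \<open>(2, 1)\<close>, \<open>(0, 1)\<close> determine
    \<open>x1\<close>, \<open>x3\<close>, \<open>x4\<close>; the diagonal remainder \<open>a\<close>
    is then interpolated at \<open>ths 0\<close> and \<open>ths 1\<close>.\<close>
  define p1 where "p1 = cv 1 (X (v 0)) / cv 1 (A (v 0))"
  define p2 where "p2 = cv 2 (X (v 1)) / cv 2 (A (v 1))"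
  define p3 where "p3 = cv 0 (X (v 1)) / cv 0 (A (v 1))"
  define x4 where "x4 = (p2 - p3) / (ths 2 - ths 0)"
  define x3 where "x3 = (p3 - p1 + x4 * (ths 1 - ths 0)) / (ths 1 - ths 0)"
  define x1 where "x1 = p1 - x3 * ths 0 - x4 * ths 1"
  define a where "a i = cv i (X (v i)) - (x1 + (x3 + x4) * ths i) * cv i (A (v i))" for i
  define x2 where "x2 = (a 1 - a 0) / (ths 1 - ths 0)"
  define x0 where "x0 = a 0 - x2 * ths 0"
  have x4: "x4 * (ths 2 - ths 0) = p2 - p3" using ne by (simp add: x4_def)
  have x3: "x3 * (ths 1 - ths 0) = p3 - p1 + x4 * (ths 1 - ths 0)" using ne by (simp add: x3_def)
  have x2: "x2 * (ths 1 - ths 0) = a 1 - a 0" using ne by (simp add: x2_def)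
  have p: "p1 = x1 + x3 * ths 0 + x4 * ths 1" "p2 = x1 + x3 * ths 1 + x4 * ths 2"
    "p3 = x1 + x3 * ths 1 + x4 * ths 0"
    using x4 x3 x1_def by algebra+
  have a: "a 0 = x0 + x2 * ths 0" "a 1 = x0 + x2 * ths 1"
    using x2 x0_def by algebra+
  define Y where "Y x = x0 *s x + x1 *s A x + x2 *s As x + x3 *s A (As x) + x4 *s As (A x)" for x
  have Y: "Y \<in> End scale" by (rule P.T.EndI) (simp_all add: Y_def End_simps algebra_simps)
  have Yv: "cv i (Y (v j)) = (x1 + x3 * ths j + x4 * ths i) * cv i (A (v j)) + (if i = j then x0 + x2 * ths i else 0)"
    if "i < n" "j < n" for i j
    using that by (simp add: Y_def Q.A_e Q.ce_A End_simps P.T.c_linear P.T.c_e algebra_simps)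
  have Yu: "cu i (Y (u j)) = (x2 + x3 * th i + x4 * th j) * cu i (As (u j)) + (if i = j then x0 + x1 * th i else 0)"
    if "i < n" "j < n" for i j
    using that by (simp add: Y_def P.A_e P.ce_A End_simps P.D.c_linear P.D.c_e algebra_simps)
  have "X x - Y x = 0" for x
  proof (rule bitridiagonal_eq_0[of "\<lambda>x. X x - Y x"])
    show "(\<lambda>x. X x - Y x) \<in> End scale"
      by (rule P.T.EndI) (simp_all add: P.T.End_add[OF X] P.T.End_add[OF Y] P.T.End_scale[OF X] P.T.End_scale[OF Y] algebra_simps)
    show "cv i (X (v j) - Y (v j)) = 0" if "i < n" "j < n" "i + 1 < j \<or> j + 1 < i" for i j
      using that v[OF that] P.tri[OF that] by (auto simp: P.T.c_linear Yv)
    show "cu i (X (u j) - Y (u j)) = 0" if "i < n" "j < n" "i + 1 < j \<or> j + 1 < i" for i j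
      using that u[OF that] Q.tri[OF that] by (auto simp: P.D.c_linear Yu)
    show "X (v 0) - Y (v 0) = 0"
    proof (rule P.T.coords_eqI)
      fix i assume i: "i < n"
      consider "i = 0" | "i = 1" | "1 < i" by linarith
      then show "cv i (X (v 0) - Y (v 0)) = cv i 0"
      proof cases
        case 1
        then show ?thesis using a(1) lt by (simp add: P.T.c_linear Yv a_def algebra_simps)
      next
        case 2
        then show ?thesis using p(1) lt irr by (simp add: P.T.c_linear Yv p1_def field_simps)
      next
        case 3
        then show ?thesis using v[of i 0] P.tri[of i 0] i lt by (simp add: P.T.c_linear Yv)
      qed
    qed
    show "X (v 1) - Y (v 1) = 0"
    proof (rule P.T.coords_eqI)
      fix i assume i: "i < n"
      consider "i = 0" | "i = 1" | "i = 2" | "2 < i" by linarith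
      then show "cv i (X (v 1) - Y (v 1)) = cv i 0"
      proof cases
        case 1
        then show ?thesis using p(3) lt irr by (simp add: P.T.c_linear Yv p3_def field_simps)
      next
        case 2
        then show ?thesis using a(2) lt by (simp add: P.T.c_linear Yv a_def algebra_simps)
      next
        case 3
        then show ?thesis using p(2) lt irr by (simp add: P.T.c_linear Yv p2_def field_simps)
      next
        case 4
        then show ?thesis using v[of i 1] P.tri[of i 1] i lt by (simp add: P.T.c_linear Yv)
      qed
    qed
  qed (use lt in simp)
  then have "X x = Y x" for x by simp
  then show thesis unfolding Y_def by (rule that)
qed

end

section \<open>Self-duality and a zero diagonal element from spin\<close>

context leonard_coords
begin

text \<open>Commuting with a multiplicity-free operator makes \<open>W\<close> and \<open>Ws\<close>
  diagonal, with nonzero eigenvalues by injectivity. The spin relation is cleared of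
  inverses.\<close>

lemma spin_data:
  assumes "has_spin scale A As"
  obtains W Ws w ws where "invertible_End scale W" "invertible_End scale Ws"
    "\<And>x. W (A x) = A (W x)" "\<And>x. Ws (W (As x)) = A (Ws (W x))"
    "\<And>i. i < n \<Longrightarrow> W (u i) = w i *s u i" "\<And>i. i < n \<Longrightarrow> w i \<noteq> 0"
    "\<And>i. i < n \<Longrightarrow> Ws (v i) = ws i *s v i" "\<And>i. i < n \<Longrightarrow> ws i \<noteq> 0"
proof -
  obtain W Ws where W: "invertible_End scale W" and Ws: "invertible_End scale Ws"
    and comm: "W \<circ> A = A \<circ> W" "Ws \<circ> As = As \<circ> Ws"
    and eq: "W \<circ> As \<circ> inv W = inv Ws \<circ> A \<circ> Ws"
    using assms by (auto simp: has_spin_def)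
  have WE: "W \<in> End scale" "bij W" and WsE: "Ws \<in> End scale" "bij Ws"
    using W Ws by (auto simp: invertible_End_def)
  have c1: "W (A x) = A (W x)" and c2: "Ws (As x) = As (Ws x)" for x
    using comm by (simp_all add: fun_eq_iff)
  have c3: "Ws (W (As x)) = A (Ws (W x))" for x
    using fun_cong[OF eq, of "W x"] WE(2) WsE(2)
    by (simp add: bij_is_inj inv_f_f) (metis bij_is_surj surj_f_inv_f)
  have nz: "cu i (W (u i)) \<noteq> 0" "cv i (Ws (v i)) \<noteq> 0" if "i < n" for i
  proof -
    have u: "W (u i) = cu i (W (u i)) *s u i"
      by (rule P.D.commuting_diagonal[OF P.A P.A_e P.inj_th WE(1) c1 that])
    have v: "Ws (v i) = cv i (Ws (v i)) *s v i"
      by (rule P.T.commuting_diagonal[OF Q.A Q.A_e Q.inj_th WsE(1) c2 that])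
    have "W (u i) \<noteq> W 0" "Ws (v i) \<noteq> Ws 0"
      using P.D.e_nonzero P.T.e_nonzero that WE(2) WsE(2) by (auto dest: injD[OF bij_is_inj])
    then show "cu i (W (u i)) \<noteq> 0" "cv i (Ws (v i)) \<noteq> 0"
      using u v by (auto simp: P.T.End_zero[OF WE(1)] P.T.End_zero[OF WsE(1)])
  qed
  show thesis
    by (rule that[OF W Ws c1 c3, of "\<lambda>i. cu i (W (u i))" "\<lambda>i. cv i (Ws (v i))"])
      (use nz P.D.commuting_diagonal[OF P.A P.A_e P.inj_th WE(1) c1]
        P.T.commuting_diagonal[OF Q.A Q.A_e Q.inj_th WsE(1) c2] in auto)
qed

text \<open>Being diagonal in orthogonal bases, \<open>W\<close> and \<open>Ws\<close> are
  self-adjoint. The relation \<open>Ws W As = A Ws W\<close> and its adjoint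
  \<open>As W Ws = W Ws A\<close> show that \<open>T = W Ws W\<close> intertwines \<open>A\<close>
  and \<open>As\<close> in both directions.\<close>

lemma self_dual_if_spin:
  assumes "has_spin scale A As"
  shows "self_dual scale A As"
proof -
  obtain W Ws w ws where W: "invertible_End scale W" and Ws: "invertible_End scale Ws"
    and WA: "\<And>x. W (A x) = A (W x)" and c: "\<And>x. Ws (W (As x)) = A (Ws (W x))"
    and Wu: "\<And>i. i < n \<Longrightarrow> W (u i) = w i *s u i" and w: "\<And>i. i < n \<Longrightarrow> w i \<noteq> 0"
    and Wsv: "\<And>i. i < n \<Longrightarrow> Ws (v i) = ws i *s v i" and ws: "\<And>i. i < n \<Longrightarrow> ws i \<noteq> 0"
    using spin_data[OF assms] by blast
  have WE: "W \<in> End scale" "bij W" and WsE: "Ws \<in> End scale" "bij Ws"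
    using W Ws by (auto simp: invertible_End_def)
  have cuW: "cu i (W x) = w i * cu i x" if "i < n" for i x
    by (rule P.D.c_eigenbasis[OF WE(1) Wu that])
  have cvWs: "cv i (Ws x) = ws i * cv i x" if "i < n" for i x
    by (rule P.T.c_eigenbasis[OF WsE(1) Wsv that])
  have form_Ws: "form (Ws x) y = form x (Ws y)" for x y
    by (simp add: form_def cvWs algebra_simps)
  have form_W: "form (W x) y = form x (W y)" for x y
  proof -
    have "form (W x) y = (\<Sum>j<n. cu j y * form (W x) (u j))"
      by (rule P.D.functional_expand) (simp_all add: form_add form_scale)
    also have "\<dots> = (\<Sum>j<n. cu j y * form x (W (u j)))"
    proof (rule sum.cong[OF refl])
      fix j assume j: "j \<in> {..<n}"
      then have "form (W x) (u j) = form x (W (u j))"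
        using form_u[of j "W x"] form_u[of j x] by (simp only: lessThan_iff cuW Wu form_scale mult.left_commute)
      then show "cu j y * form (W x) (u j) = cu j y * form x (W (u j))" by simp
    qed
    also have "\<dots> = form x (W y)"
      by (rule P.D.functional_expand[symmetric])
        (simp_all add: form_add form_scale P.T.End_add[OF WE(1)] P.T.End_scale[OF WE(1)])
    finally show ?thesis .
  qed
  have c': "As (W (Ws x)) = W (Ws (A x))" for x
  proof (rule form_eqI)
    fix y
    have "form (As (W (Ws x))) y = form x (Ws (W (As y)))"
      by (simp only: form_As form_W form_Ws)
    also have "\<dots> = form (W (Ws (A x))) y"
      by (simp only: c form_A form_W form_Ws)
    finally show "form (As (W (Ws x))) y = form (W (Ws (A x))) y" .
  qed
  define T where "T = W \<circ> Ws \<circ> W"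
  have T: "T \<in> End scale" "bij T"
    unfolding T_def using WE WsE by (auto intro!: P.T.End_comp bij_comp)
  then have inv: "invertible_End scale T" by (simp add: invertible_End_def)
  note Ti = P.T.End_inv[OF inv]
  have iT: "inv T (T x) = x" "T (inv T x) = x" for x
    using T(2) by (simp_all add: bij_is_inj bij_is_surj inv_f_f surj_f_inv_f)
  have TA: "T (A x) = As (T x)" and TAs: "T (As x) = A (T x)" for x
    by (simp_all add: T_def WA c' c)
  define \<sigma> where "\<sigma> X = T \<circ> X \<circ> inv T" for X :: "'v \<Rightarrow> 'v"
  define \<tau> where "\<tau> X = inv T \<circ> X \<circ> T" for X :: "'v \<Rightarrow> 'v"
  have "bij_betw \<sigma> (End scale) (End scale)"
    by (rule bij_betw_byWitness[where f' = \<tau>])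
      (auto simp: \<sigma>_def \<tau>_def iT fun_eq_iff P.T.End_comp T(1) Ti)
  then have "End_algebra_iso scale \<sigma>"
    by (auto simp: End_algebra_iso_def \<sigma>_def fun_eq_iff iT P.T.End_add[OF T(1)] P.T.End_scale[OF T(1)])
  moreover have "\<sigma> A = As" "\<sigma> As = A" by (auto simp: \<sigma>_def TA TAs iT)
  ultimately show ?thesis unfolding self_dual_def leonard_pairs_isomorphic_def by blast
qed

lemma zero_diagonal_if_spin:
  assumes "has_spin scale A As" and n: "2 < n"
  shows "zero_diagonal_space scale A As \<noteq> {\<lambda>v. 0}"
proof -
  note One_nat_def [simp del]
  have lt: "0 < n" "1 < n" "2 < n" using n by auto
  obtain W Ws w ws where W: "invertible_End scale W" and Ws: "invertible_End scale Ws"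
    and WA: "\<And>x. W (A x) = A (W x)" and c: "\<And>x. Ws (W (As x)) = A (Ws (W x))"
    and Wu: "\<And>i. i < n \<Longrightarrow> W (u i) = w i *s u i" and w: "\<And>i. i < n \<Longrightarrow> w i \<noteq> 0"
    and Wsv: "\<And>i. i < n \<Longrightarrow> Ws (v i) = ws i *s v i" and ws: "\<And>i. i < n \<Longrightarrow> ws i \<noteq> 0"
    using spin_data[OF assms(1)] by blast
  have WE: "W \<in> End scale" "bij W" and WsE: "Ws \<in> End scale"
    using W Ws by (auto simp: invertible_End_def)
  note cuW = P.D.c_eigenbasis[OF WE(1) Wu]
  note cvWs = P.T.c_eigenbasis[OF WsE Wsv]
  \<comment> \<open>\<open>B\<close> is a conjugate of \<open>As\<close> by \<open>W\<close> and of
    \<open>A\<close> by \<open>Ws\<close>, so diagonal rescaling makes it tridiagonal in both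
    bases.\<close>
  define B where "B x = W (As (inv W x))" for x
  have B: "B \<in> End scale"
    using P.T.End_comp[OF WE(1) P.T.End_comp[OF Q.A P.T.End_inv[OF W]]] by (simp add: B_def[abs_def] comp_def)
  have BW: "B (W x) = W (As x)" for x
    using WE(2) by (simp add: B_def bij_is_inj inv_f_f)
  have WsB: "Ws (B x) = A (Ws x)" for x
    using WE(2) by (simp add: B_def c bij_is_surj surj_f_inv_f)
  have Bu: "w j * cu i (B (u j)) = w i * cu i (As (u j))" if "i < n" "j < n" for i j
    using arg_cong[OF BW[of "u j"], of "cu i"] that
    by (simp add: Wu P.T.End_scale[OF B] P.D.c_linear cuW)
  have Bv: "ws i * cv i (B (v j)) = ws j * cv i (A (v j))" if "i < n" "j < n" for i j
    using arg_cong[OF WsB[of "v j"], of "cv i"] that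
    by (simp add: Wsv End_simps P.T.c_linear cvWs)
  have v_tri: "cv i (B (v j)) = 0" if "i < n" "j < n" "i + 1 < j \<or> j + 1 < i" for i j
    using Bv[OF that(1,2)] P.tri[OF that] ws[OF that(1)] by simp
  have u_tri: "cu i (B (u j)) = 0" if "i < n" "j < n" "i + 1 < j \<or> j + 1 < i" for i j
    using Bu[OF that(1,2)] Q.tri[OF that] w[OF that(2)] by simp
  obtain x0 x1 x2 x3 x4 where
    X: "\<And>x. B x = x0 *s x + x1 *s A x + x2 *s As x + x3 *s A (As x) + x4 *s As (A x)"
    using bitridiagonal_span[OF B v_tri u_tri n] by blast
  have cvB: "cv i (B (v j)) = (x1 + x3 * ths j + x4 * ths i) * cv i (A (v j)) + (if i = j then x0 + x2 * ths i else 0)"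
    if "i < n" "j < n" for i j
    using that by (simp add: X Q.A_e Q.ce_A End_simps P.T.c_linear P.T.c_e algebra_simps)
  have diag: "x0 + x2 * ths i + (x1 - 1 + (x3 + x4) * ths i) * cv i (A (v i)) = 0" if i: "i < n" for i
  proof -
    have "cv i (B (v i)) = cv i (A (v i))" using Bv[OF i i] ws[OF i] by simp
    then show ?thesis using cvB[OF i i] by (simp add: algebra_simps)
  qed
  \<comment> \<open>This is \<open>B - A\<close> with \<open>As A\<close> replaced by
    \<open>A As\<close>; both products have the same diagonal in the eigenbasis \<open>v\<close> of
    \<open>As\<close>.\<close>
  define Y where "Y x = x0 *s x + x2 *s As x + (x1 - 1) *s A x + (x3 + x4) *s A (As x)" for x
  have cvY: "cv i (Y (v j)) = (x1 - 1 + (x3 + x4) * ths j) * cv i (A (v j)) + (if i = j then x0 + x2 * ths j else 0)"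
    if "i < n" "j < n" for i j
    using that by (simp add: Y_def Q.A_e End_simps P.T.c_linear P.T.c_e algebra_simps)
  have irr: "cv 1 (A (v 0)) \<noteq> 0" "cv 0 (A (v 1)) \<noteq> 0" "cv 2 (A (v 1)) \<noteq> 0"
    using P.irred[of 0] P.irred(2)[of 1] lt by auto
  have ne: "ths 0 \<noteq> ths 1" using lt by (simp add: Q.th_eq_iff)
  \<comment> \<open>If \<open>Y = 0\<close>, then \<open>B = A + x3 [A, As]\<close>. It will follow
    that \<open>x3 = 0\<close> and \<open>B = A\<close>, hence \<open>As = A\<close>, which is
    absurd since only \<open>A\<close> has a nonzero \<open>(1, 0)\<close> entry in
    \<open>v\<close>.\<close>
  have "\<exists>x. Y x \<noteq> 0"
  proof (rule ccontr)
    assume "\<not> ?thesis"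
    then have Y0: "Y x = 0" for x by simp
    have "x1 - 1 + (x3 + x4) * ths 0 = 0" "x1 - 1 + (x3 + x4) * ths 1 = 0"
      using cvY[of 1 0] cvY[of 2 1] irr lt by (simp_all add: Y0 P.T.c_zero)
    moreover from this have "(x3 + x4) * (ths 0 - ths 1) = 0" by algebra
    ultimately have x34: "x4 = - x3" and x1: "x1 = 1" using ne by (auto simp: add_eq_0_iff)
    have "x0 + x2 * ths 0 = 0" "x0 + x2 * ths 1 = 0"
      using diag[OF lt(1)] diag[OF lt(2)] x34 x1 by simp_all
    moreover from this have "x2 * (ths 0 - ths 1) = 0" by algebra
    ultimately have x02: "x0 = 0" "x2 = 0" using ne by auto
    have "ws 1 * (1 + x3 * (ths 0 - ths 1)) * cv 1 (A (v 0)) = ws 0 * cv 1 (A (v 0))"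
      "ws 0 * (1 + x3 * (ths 1 - ths 0)) * cv 0 (A (v 1)) = ws 1 * cv 0 (A (v 1))"
      using Bv[of 1 0] Bv[of 0 1] lt by (simp_all add: cvB x34 x1 algebra_simps)
    then have ws01: "ws 1 * (1 + x3 * (ths 0 - ths 1)) = ws 0" "ws 0 * (1 + x3 * (ths 1 - ths 0)) = ws 1"
      using irr by auto
    \<comment> \<open>The two ratios of weights are inverse, so \<open>(1 + z) * (1 - z) = 1\<close>
      for \<open>z = x3 * (ths 0 - ths 1)\<close>, and \<open>z^2 = 0\<close>.\<close>
    have "ws 1 * (1 + x3 * (ths 0 - ths 1)) * (1 + x3 * (ths 1 - ths 0)) = ws 1"
      by (simp only: ws01)
    then have "ws 1 * (x3 * (ths 0 - ths 1))^2 = 0"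
      by (simp add: algebra_simps power2_eq_square)
    then have x3: "x3 = 0" using ws[OF lt(2)] ne by simp
    have BA: "B x = A x" for x by (simp add: X x02 x1 x34 x3)
    have "W (As x) = W (A x)" for x by (simp add: BW[symmetric] BA WA)
    then have "As x = A x" for x using injD[OF bij_is_inj[OF WE(2)]] by blast
    then have "cv 1 (A (v 0)) = cv 1 (As (v 0))" by simp
    then show False using irr(1) lt by (simp add: Q.A_e P.T.c_linear P.T.c_e)
  qed
  then have "(\<lambda>x. x0 *s x + x2 *s As x + (x1 - 1) *s A x + (x3 + x4) *s A (As x)) \<noteq> (\<lambda>x. 0)"
    unfolding Y_def[symmetric] by (auto simp: fun_eq_iff)
  then show ?thesis
    unfolding P.T.zero_diagonal_space_iff[where t = ths, OF Q.A Q.A_e Q.inj_th P.A, simplified] using diag by blast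
qed

end

section \<open>Eigenbases of a given Leonard pair and the two implications\<close>

theorem theorem14p5:
  fixes scale :: "'f::alg_closed_field \<Rightarrow> 'v::ab_group_add \<Rightarrow> 'v"
    and A As :: "'v \<Rightarrow> 'v"
    and d :: nat
  assumes "vector_space scale"
    and "vector_space.dim scale (UNIV :: 'v set) = d + 1"
    and "d \<ge> 3"
    and "leonard_pair scale A As"
  shows "has_spin scale A As \<longleftrightarrow>
    self_dual scale A As \<and>
    zero_diagonal_space scale A As \<noteq> {\<lambda>v. 0}"
proof -
  define n where "n = dimV scale"
  have n: "n \<ge> 4" using assms(2,3) by (simp add: n_def dimV_def)
  obtain v u where v: "ordered_basis scale v" "irreducible_tridiagonal_matrix n (matrix_wrt scale v A)"
      "diagonal_matrix n (matrix_wrt scale v As)"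
    and u: "ordered_basis scale u" "irreducible_tridiagonal_matrix n (matrix_wrt scale u As)"
      "diagonal_matrix n (matrix_wrt scale u A)"
    and A: "A \<in> End scale" and As: "As \<in> End scale"
    using assms(4) by (auto simp: leonard_pair_def n_def)
  define cv where "cv i x = module.representation scale (v ` {..<n}) x (v i)" for i x
  define cu where "cu i x = module.representation scale (u ` {..<n}) x (u i)" for i x
  interpret V: coords scale n v cv
    using coords_of_ordered_basis[OF assms(1) v(1)] by (simp add: cv_def[abs_def] n_def)
  interpret U: coords scale n u cu
    using coords_of_ordered_basis[OF assms(1) u(1)] by (simp add: cu_def[abs_def] n_def)
  have Mv: "matrix_wrt scale v X i j = cv i (X (v j))" for X i j
    by (simp add: matrix_wrt_def cv_def n_def)
  have Mu: "matrix_wrt scale u X i j = cu i (X (u j))" for X i j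
    by (simp add: matrix_wrt_def cu_def n_def)
  define th where "th j = cu j (A (u j))" for j
  define ths where "ths j = cv j (As (v j))" for j
  have Au: "A (u j) = scale (th j) (u j)" if "j < n" for j
    by (rule U.coords_eqI) (use u(3) that in \<open>auto simp: diagonal_matrix_def Mu U.c_scale U.c_e th_def\<close>)
  have Asv: "As (v j) = scale (ths j) (v j)" if "j < n" for j
    by (rule V.coords_eqI) (use v(3) that in \<open>auto simp: diagonal_matrix_def Mv V.c_scale V.c_e ths_def\<close>)
  interpret L: leonard_coords scale n v cv u cu A th As ths
    by unfold_locales (use v(2) u(2) A As Au Asv n in
      \<open>auto simp: irreducible_tridiagonal_matrix_def tridiagonal_matrix_def Mv Mu\<close>)
  show ?thesis
  proof (intro iffI conjI)
    assume "has_spin scale A As"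
    then show "self_dual scale A As" "zero_diagonal_space scale A As \<noteq> {\<lambda>v. 0}"
      using L.self_dual_if_spin L.zero_diagonal_if_spin n by auto
  next
    assume *: "self_dual scale A As \<and> zero_diagonal_space scale A As \<noteq> {\<lambda>v. 0}"
    \<comment> \<open>The tridiagonal basis for \<open>A\<close> is now the image of
      \<open>u\<close> under the map implementing the duality, in place of \<open>v\<close>.\<close>
    obtain t ct M where "self_dual_pair scale n t ct u cu A th As M"
      using U.self_dual_pair_if_self_dual[OF conjunct1[OF *] n A Au As L.Q.tri L.Q.irred] by blast
    then show "has_spin scale A As"
      using conjunct2[OF *] by (rule has_spin_if_zero_diagonal)
  qed
qed

end
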